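(* Every bipartite graph that has no induced subgraph isomorphic to $2P_3$ and is right-Sperner has clique-width at most $5$. Moreover, given such a graph $G$, one can compute a $5$-expression of $G$ in time $\mathcal{O}(|V(G)|^4)$.
   Context: A bipartite graph $G$ is right-Sperner if it has a bipartition $(A,B)$ into independent sets such that for all $u,v\in B$, $N(u)\subseteq N(v)$ implies $u=v$. $2P_3$ is the disjoint union of two 3-vertex paths. A $k$-graph is a graph with vertex labels from $\{1,\dots,k\}$. A $k$-expression is an expression built from: $i(v)$ (create vertex $v$ with label $i$), $\oplus$ (disjoint union), $\rho_{i\to j}$ (relabel label $i$ to $j$), and $\eta_{i,j}$ for $i\ne j$ (add all edges between vertices labeled $i$ and $j$). The clique-width of $G$ is the least $k$ such that some $k$-expression produces a $k$-graph isomorphic to $G$. *)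

theory Defs
  imports "HOL-Library.Landau_Symbols" "HOL-Library.Extended_Nat"
begin

section \<open>Graphs\<close>

record 'a graph =
  verts :: "'a set"
  edges :: "'a set set"

definition simple_graph :: "('a, 'm) graph_scheme \<Rightarrow> bool" where
  "simple_graph G \<longleftrightarrow> finite (verts G) \<and> (\<forall>e \<in> edges G. e \<subseteq> verts G \<and> card e = 2)"

definition neighbours :: "('a, 'm) graph_scheme \<Rightarrow> 'a \<Rightarrow> 'a set" where
  "neighbours G v = {u. {u, v} \<in> edges G}"

definition graph_iso :: "('a, 'm) graph_scheme \<Rightarrow> ('b, 'n) graph_scheme \<Rightarrow> bool" where
  "graph_iso G H \<longleftrightarrow> (\<exists>f. bij_betw f (verts G) (verts H) \<and>
     (\<forall>u \<in> verts G. \<forall>v \<in> verts G. {u, v} \<in> edges G \<longleftrightarrow> {f u, f v} \<in> edges H))"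

definition induced_subgraph :: "'a graph \<Rightarrow> 'a set \<Rightarrow> 'a graph" where
  "induced_subgraph G S = \<lparr>verts = S, edges = {e \<in> edges G. e \<subseteq> S}\<rparr>"

definition has_induced :: "'a graph \<Rightarrow> 'b graph \<Rightarrow> bool" where
  "has_induced G H \<longleftrightarrow> (\<exists>S \<subseteq> verts G. graph_iso (induced_subgraph G S) H)"

definition two_P3 :: "nat graph" where
  "two_P3 = \<lparr>verts = {0, 1, 2, 3, 4, 5}, edges = {{0, 1}, {1, 2}, {3, 4}, {4, 5}}\<rparr>"

definition independent :: "'a graph \<Rightarrow> 'a set \<Rightarrow> bool" where
  "independent G S \<longleftrightarrow> (\<forall>u \<in> S. \<forall>v \<in> S. {u, v} \<notin> edges G)"

definition bipartition :: "'a graph \<Rightarrow> 'a set \<Rightarrow> 'a set \<Rightarrow> bool" where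
  "bipartition G A B \<longleftrightarrow>
     A \<union> B = verts G \<and> A \<inter> B = {} \<and> independent G A \<and> independent G B"

definition bipartite :: "'a graph \<Rightarrow> bool" where
  "bipartite G \<longleftrightarrow> (\<exists>A B. bipartition G A B)"

definition right_Sperner :: "'a graph \<Rightarrow> bool" where
  "right_Sperner G \<longleftrightarrow> (\<exists>A B. bipartition G A B \<and>
     (\<forall>u \<in> B. \<forall>v \<in> B. neighbours G u \<subseteq> neighbours G v \<longrightarrow> u = v))"


section \<open>Clique-width\<close>

record 'a labelled_graph = "'a graph" +
  label :: "'a \<Rightarrow> nat"

datatype 'a cw_expr =
    Create nat 'a
  | Union "'a cw_expr" "'a cw_expr"
  | Relabel nat nat "'a cw_expr"
  | Join nat nat "'a cw_expr"

primrec graph_of :: "'a cw_expr \<Rightarrow> 'a labelled_graph" where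
  "graph_of (Create i v) = \<lparr>verts = {v}, edges = {}, label = (\<lambda>_. i)\<rparr>"
| "graph_of (Union a b) =
     \<lparr>verts = verts (graph_of a) \<union> verts (graph_of b),
      edges = edges (graph_of a) \<union> edges (graph_of b),
      label = (\<lambda>v. if v \<in> verts (graph_of a) then label (graph_of a) v
                   else label (graph_of b) v)\<rparr>"
| "graph_of (Relabel i j a) =
     (graph_of a)\<lparr>label := (\<lambda>v. if label (graph_of a) v = i then j
                                else label (graph_of a) v)\<rparr>"
| "graph_of (Join i j a) =
     (graph_of a)\<lparr>edges := edges (graph_of a) \<union>
        {{u, v} | u v. u \<in> verts (graph_of a) \<and> v \<in> verts (graph_of a) \<and>
                       label (graph_of a) u = i \<and> label (graph_of a) v = j}\<rparr>"

text \<open>Vertices are named, so the union is a disjoint union only if the two vertex sets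
  are disjoint; this is part of being a well-formed expression.\<close>

primrec k_expression :: "nat \<Rightarrow> 'a cw_expr \<Rightarrow> bool" where
  "k_expression k (Create i v) \<longleftrightarrow> i \<in> {1..k}"
| "k_expression k (Union a b) \<longleftrightarrow> k_expression k a \<and> k_expression k b \<and>
     verts (graph_of a) \<inter> verts (graph_of b) = {}"
| "k_expression k (Relabel i j a) \<longleftrightarrow> i \<in> {1..k} \<and> j \<in> {1..k} \<and> k_expression k a"
| "k_expression k (Join i j a) \<longleftrightarrow> i \<in> {1..k} \<and> j \<in> {1..k} \<and> i \<noteq> j \<and> k_expression k a"

text \<open>As the produced graph need only be isomorphic to \<open>G\<close>, it is enough to draw vertex
  names from the natural numbers. The value is \<open>\<infinity>\<close> if there is no expression at all, i.e.
  for the graph without vertices and for infinite graphs.\<close>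

definition clique_width :: "'a graph \<Rightarrow> enat" where
  "clique_width G =
     Inf {enat k | k. \<exists>e :: nat cw_expr. k_expression k e \<and> graph_iso (graph_of e) G}"

definition expression_of :: "'a cw_expr \<Rightarrow> 'a graph \<Rightarrow> bool" where
  "expression_of e G \<longleftrightarrow> verts (graph_of e) = verts G \<and> edges (graph_of e) = edges G"


section \<open>Running time\<close>

text \<open>Structured programs for a random access machine under the uniform cost measure. A
  program has registers and arrays, all holding natural numbers. Registers and arrays are
  named statically, so that a program uses only finitely many of them, while array indices
  are computed. Arithmetic is limited to addition and truncated subtraction, and every
  operation costs one step. (Without multiplication, the uniform cost measure does not
  allow unreasonably large numbers to be built up quickly.)\<close>

record state =
  reg :: "nat \<Rightarrow> nat"
  arr :: "nat \<Rightarrow> nat \<Rightarrow> nat"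

datatype aexp =
    Const nat
  | Reg nat
  | Arr nat aexp
  | Plus aexp aexp
  | Minus aexp aexp

datatype bexp =
    Less aexp aexp
  | Equal aexp aexp
  | Not bexp
  | And bexp bexp

datatype com =
    Skip
  | Assign nat aexp
  | Store nat aexp aexp
  | Seq com com
  | If bexp com com
  | While bexp com

primrec aval :: "aexp \<Rightarrow> state \<Rightarrow> nat" where
  "aval (Const c) s = c"
| "aval (Reg x) s = reg s x"
| "aval (Arr a i) s = arr s a (aval i s)"
| "aval (Plus x y) s = aval x s + aval y s"
| "aval (Minus x y) s = aval x s - aval y s"

primrec bval :: "bexp \<Rightarrow> state \<Rightarrow> bool" where
  "bval (Less x y) s \<longleftrightarrow> aval x s < aval y s"
| "bval (Equal x y) s \<longleftrightarrow> aval x s = aval y s"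
| "bval (Not b) s \<longleftrightarrow> \<not> bval b s"
| "bval (And b c) s \<longleftrightarrow> bval b s \<and> bval c s"

primrec acost :: "aexp \<Rightarrow> nat" where
  "acost (Const c) = 1"
| "acost (Reg x) = 1"
| "acost (Arr a i) = acost i + 1"
| "acost (Plus x y) = acost x + acost y + 1"
| "acost (Minus x y) = acost x + acost y + 1"

primrec bcost :: "bexp \<Rightarrow> nat" where
  "bcost (Less x y) = acost x + acost y + 1"
| "bcost (Equal x y) = acost x + acost y + 1"
| "bcost (Not b) = bcost b + 1"
| "bcost (And b c) = bcost b + bcost c + 1"

text \<open>\<open>exec c s t s'\<close>: started in state \<open>s\<close>, the program \<open>c\<close> halts in state \<open>s'\<close> after
  \<open>t\<close> steps.\<close>

inductive exec :: "com \<Rightarrow> state \<Rightarrow> nat \<Rightarrow> state \<Rightarrow> bool" where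
  Skip: "exec Skip s 1 s"
| Assign: "exec (Assign x a) s (acost a + 1) (s\<lparr>reg := (reg s)(x := aval a s)\<rparr>)"
| Store: "exec (Store m i a) s (acost i + acost a + 1)
            (s\<lparr>arr := (arr s)(m := (arr s m)(aval i s := aval a s))\<rparr>)"
| Seq: "exec c s t s' \<Longrightarrow> exec d s' t' s'' \<Longrightarrow> exec (Seq c d) s (t + t') s''"
| IfTrue: "bval b s \<Longrightarrow> exec c s t s' \<Longrightarrow> exec (If b c d) s (bcost b + 1 + t) s'"
| IfFalse: "\<not> bval b s \<Longrightarrow> exec d s t s' \<Longrightarrow> exec (If b c d) s (bcost b + 1 + t) s'"
| WhileFalse: "\<not> bval b s \<Longrightarrow> exec (While b c) s (bcost b + 1) s"
| WhileTrue: "bval b s \<Longrightarrow> exec c s t s' \<Longrightarrow> exec (While b c) s' t' s'' \<Longrightarrow>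
    exec (While b c) s (bcost b + 1 + t + t') s''"

text \<open>A graph on \<open>{..<n}\<close> is given by \<open>n\<close> in register 0 and by its adjacency matrix, row by
  row, in array 0. Everything else is 0 initially.\<close>

definition input_state :: "nat \<Rightarrow> nat graph \<Rightarrow> state" where
  "input_state n G =
     \<lparr>reg = (\<lambda>x. if x = 0 then n else 0),
      arr = (\<lambda>a k. if a = 0 \<and> k < n * n \<and> {k div n, k mod n} \<in> edges G then 1 else 0)\<rparr>"

text \<open>The result is a list of numbers, stored in array 1, with its length in register 1.\<close>

definition output_of :: "state \<Rightarrow> nat list" where
  "output_of s = map (arr s 1) [0..<reg s 1]"

text \<open>Expressions are output in postfix notation.\<close>

primrec encode :: "nat cw_expr \<Rightarrow> nat list" where
  "encode (Create i v) = [0, i, v]"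
| "encode (Union a b) = encode a @ encode b @ [1]"
| "encode (Relabel i j a) = encode a @ [2, i, j]"
| "encode (Join i j a) = encode a @ [3, i, j]"

fun decode :: "nat list \<Rightarrow> nat cw_expr list \<Rightarrow> nat cw_expr list" where
  "decode (x # xs) st =
     (if x = 0 then decode (drop 2 xs) (Create (xs ! 0) (xs ! 1) # st)
      else if x = 1 then decode xs (Union (st ! 1) (st ! 0) # drop 2 st)
      else if x = 2 then decode (drop 2 xs) (Relabel (xs ! 0) (xs ! 1) (st ! 0) # drop 1 st)
      else decode (drop 2 xs) (Join (xs ! 0) (xs ! 1) (st ! 0) # drop 1 st))"
| "decode [] st = st"

lemma decode_encode: "decode (encode e @ xs) st = decode xs (e # st)"
  by (induction e arbitrary: xs st) (simp_all add: numeral_2_eq_2)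

lemma inj_encode: "inj encode"
proof (rule injI)
  fix e e' assume "encode e = encode e'"
  then show "e = e'"
    using decode_encode[of e "[]" "[]"] decode_encode[of e' "[]" "[]"] by simp
qed

inductive_cases exec_cases:
  "exec Skip s t s'"
  "exec (Assign x a) s t s'"
  "exec (Store m i a) s t s'"
  "exec (Seq c d) s t s'"
  "exec (If b c d) s t s'"
  "exec (While b c) s t s'"

lemma exec_deterministic:
  "exec c s t s' \<Longrightarrow> exec c s u s'' \<Longrightarrow> u = t \<and> s'' = s'"
proof (induction arbitrary: u s'' rule: exec.induct)
  case (Seq c s t s' d t' s3)
  from Seq.prems obtain t1 s1 t2 where "u = t1 + t2" "exec c s t1 s1" "exec d s1 t2 s''"
    by (rule exec_cases(4))
  with Seq.IH(1)[of t1 s1] Seq.IH(2)[of t2 s''] show ?case by simp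
next
  case (IfTrue b s c t s' d)
  then obtain t1 where "u = bcost b + 1 + t1" "exec c s t1 s''"
    by (auto elim: exec_cases(5))
  with IfTrue.IH[of t1 s''] show ?case by simp
next
  case (IfFalse b s d t s' c)
  then obtain t1 where "u = bcost b + 1 + t1" "exec d s t1 s''"
    by (auto elim: exec_cases(5))
  with IfFalse.IH[of t1 s''] show ?case by simp
next
  case (WhileFalse b s c)
  from WhileFalse.prems show ?case
    by (rule exec_cases(6)) (use WhileFalse.hyps in simp_all)
next
  case (WhileTrue b s c t s' t' s3)
  from WhileTrue.prems obtain t1 s1 t2
    where "u = bcost b + 1 + t1 + t2" "exec c s t1 s1" "exec (While b c) s1 t2 s''"
    by (rule exec_cases(6)) (use WhileTrue.hyps in simp_all)
  with WhileTrue.IH(1)[of t1 s1] WhileTrue.IH(2)[of t2 s''] show ?case by simp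
qed (erule exec_cases(1-3), simp)+

end

theory Submission
  imports Defs
begin

text \<open>Regard the vertices on one side as hyperedges on the other. As \<open>2P\<^sub>3\<close> is excluded, any two
  hyperedges \<open>e\<close>, \<open>f\<close> are incomparable and \<open>e - f\<close> or \<open>f - e\<close> is a singleton. Then there is a point
  \<open>z\<close> such that every hyperedge not containing \<open>z\<close> contains all other points of the hyperedges
  containing \<open>z\<close>: otherwise every \<open>z\<close> has hyperedges \<open>e\<close>, \<open>f\<close> with \<open>z \<in> e - f\<close>, \<open>card (e - f) \<ge> 2\<close> and
  \<open>f - e = {z'}\<close>, and following \<open>z \<mapsto> z'\<close> around a cycle gives a contradiction. Such a splitter \<open>z\<close>
  divides the remaining vertices into those within distance two and the rest; both parts inherit
  the property, and between them there are only the edges joining the points of the first part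
  completely to the hyperedges of the second. So five labels suffice to put the parts together.
  There are at most \<open>n\<close> splittings, and a splitter can be found in time \<open>O(n\<^sup>3)\<close>. The splitting
  condition does not depend on which side is regarded as the hyperedges, so neither does the
  algorithm.\<close>

section \<open>Splitters\<close>

text \<open>Right-Spernerness is not hereditary, so the recursion needs a condition that survives
  splitting. Both halves of the condition on hyperedges, incomparability and the singleton
  difference, depend only on the sets \<open>e - f\<close>, and a splitter leaves these sets
  unchanged within either part. The number five is two sides times two parts, plus a private label
  for the splitter. The machine has no recursion, so the expression is unfolded from the outside,
  with a stack of classes still to be expanded, and emitted in postfix order. The bound on the
  clique-width is read off from the correctness of the program after the vertices have been renamed
  to numbers.\<close>

locale bipartite_relation =
  fixes adj :: "'v \<Rightarrow> 'v \<Rightarrow> bool" and side :: "'v \<Rightarrow> nat"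
  assumes adj_sym: "adj u v \<Longrightarrow> adj v u"
    and adj_side: "adj u v \<Longrightarrow> side u \<noteq> side v"
    and side_range: "side v = 1 \<or> side v = 2"
begin

definition nbhd :: "'v set \<Rightarrow> 'v \<Rightarrow> 'v set" where
  "nbhd C v = {u \<in> C. adj v u}"

definition near :: "'v set \<Rightarrow> 'v \<Rightarrow> 'v set" where
  "near C z = {w \<in> C. \<exists>e \<in> C. adj z e \<and> (w = e \<or> (adj e w \<and> w \<noteq> z))}"

definition splitter :: "'v set \<Rightarrow> 'v \<Rightarrow> bool" where
  "splitter C z \<longleftrightarrow> z \<in> C \<and>
     (\<forall>f \<in> C. side f \<noteq> side z \<and> \<not> adj z f \<longrightarrow> (\<forall>w \<in> near C z. side w = side z \<longrightarrow> adj f w))"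

text \<open>Isolated vertices are exempt because a computed bipartition may put them on either side.\<close>

definition one_Sperner :: "nat \<Rightarrow> 'v set \<Rightarrow> bool" where
  "one_Sperner s C \<longleftrightarrow>
     (\<forall>e \<in> C. \<forall>f \<in> C. side e = s \<and> side f = s \<and> e \<noteq> f \<and> nbhd C e \<noteq> {} \<and> nbhd C f \<noteq> {} \<longrightarrow>
        \<not> nbhd C e \<subseteq> nbhd C f \<and>
        (card (nbhd C e - nbhd C f) \<le> 1 \<or> card (nbhd C f - nbhd C e) \<le> 1))"

lemma other_side: "side u \<noteq> side w \<Longrightarrow> side v \<noteq> side w \<Longrightarrow> side u = side v"
  using side_range[of u] side_range[of v] side_range[of w] by auto

lemma near_side: "w \<in> near C z \<Longrightarrow> side w = side z \<longleftrightarrow> \<not> adj z w"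
  using adj_side[of z w] adj_side[of z] adj_side[of _ w] other_side[of w _ z]
  unfolding near_def by (auto; metis)

lemma not_near_self: "z \<notin> near C z"
  using adj_side by (auto simp: near_def)

text \<open>Inclusion means that a difference is empty, so the condition speaks about the sets
  \<open>nbhd C e - nbhd C f\<close> alone. The hypothesis \<open>ne\<close> takes care of the
  exemption: what is not isolated in \<open>D\<close> is not isolated in \<open>C\<close>.\<close>

lemma one_Sperner_transfer:
  assumes "one_Sperner s C" and "D \<subseteq> C"
    and ne: "\<And>e. e \<in> D \<Longrightarrow> side e = s \<Longrightarrow> nbhd D e \<subseteq> nbhd C e"
    and diff: "\<And>e f. e \<in> D \<Longrightarrow> f \<in> D \<Longrightarrow> side e = s \<Longrightarrow> side f = s \<Longrightarrow>
      nbhd D e - nbhd D f = nbhd C e - nbhd C f"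
  shows "one_Sperner s D"
  unfolding one_Sperner_def
proof (intro ballI impI, elim conjE)
  fix e f assume *: "e \<in> D" "f \<in> D" "side e = s" "side f = s" "e \<noteq> f" "nbhd D e \<noteq> {}" "nbhd D f \<noteq> {}"
  then have "nbhd C e \<noteq> {}" "nbhd C f \<noteq> {}" "e \<in> C" "f \<in> C"
    using ne[of e] ne[of f] \<open>D \<subseteq> C\<close> by auto
  with assms(1) * have "\<not> nbhd C e \<subseteq> nbhd C f"
    "card (nbhd C e - nbhd C f) \<le> 1 \<or> card (nbhd C f - nbhd C e) \<le> 1"
    unfolding one_Sperner_def by blast+
  then show "\<not> nbhd D e \<subseteq> nbhd D f \<and>
        (card (nbhd D e - nbhd D f) \<le> 1 \<or> card (nbhd D f - nbhd D e) \<le> 1)"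
    using * by (simp only: Diff_eq_empty_iff[symmetric] diff[of e f] diff[of f e]) simp
qed

text \<open>Let \<open>w\<close> be adjacent to \<open>e\<close> but not to \<open>f\<close>. If
  \<open>z\<close> is on side \<open>s\<close>, then \<open>w\<close> is adjacent to
  \<open>z\<close>, for otherwise the splitting condition would make it adjacent to
  \<open>f\<close>; so \<open>w\<close> is near. If \<open>z\<close> is on the other side, then
  \<open>e\<close> and \<open>f\<close> are neighbours of \<open>z\<close>, and all their neighbours
  are near except \<open>z\<close> itself, which is common to both and cancels.\<close>

lemma one_Sperner_near:
  assumes "one_Sperner s C" "splitter C z"
  shows "one_Sperner s (near C z)"
proof (rule one_Sperner_transfer[OF assms(1)])
  show sub: "near C z \<subseteq> C" by (auto simp: near_def)
  show "nbhd (near C z) e \<subseteq> nbhd C e" for e using sub by (auto simp: nbhd_def)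
  fix e f assume e: "e \<in> near C z" "f \<in> near C z" "side e = s" "side f = s"
  show "nbhd (near C z) e - nbhd (near C z) f = nbhd C e - nbhd C f"
  proof (cases "side z = s")
    case True
    have "w \<in> near C z" if "w \<in> C" "adj e w" "\<not> adj f w" for w
    proof -
      have "side w \<noteq> side z" using adj_side[OF that(2)] True e by simp
      have "adj z w"
      proof (rule ccontr)
        assume "\<not> adj z w"
        then have "adj w f"
          using assms(2) that(1) \<open>side w \<noteq> side z\<close> e(2,4) True unfolding splitter_def by simp
        then show False using that(3) adj_sym by blast
      qed
      with that show ?thesis by (auto simp: near_def)
    qed
    then show ?thesis using sub by (auto simp: nbhd_def)
  next
    case False
    then have "adj z e" "adj z f" using near_side[OF e(1)] near_side[OF e(2)] e(3,4) by auto
    then have "w = z \<or> w \<in> near C z" if "w \<in> C" "adj e w" for w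
      using that e sub by (auto simp: near_def)
    with \<open>adj z f\<close> show ?thesis using sub adj_sym by (auto simp: nbhd_def)
  qed
qed

text \<open>A vertex \<open>w\<close> adjacent to \<open>e\<close> but not to \<open>f\<close>
  cannot be near. If \<open>z\<close> is on side \<open>s\<close>, a near \<open>w\<close> would be
  a neighbour of \<open>z\<close>, and then \<open>e\<close> would be near. Otherwise
  \<open>w\<close> is on the side of \<open>z\<close>, and the splitting condition would make it
  adjacent to \<open>f\<close>.\<close>

lemma one_Sperner_far:
  assumes "one_Sperner s C" "splitter C z"
  shows "one_Sperner s (C - insert z (near C z))"
proof (rule one_Sperner_transfer[OF assms(1)])
  let ?D = "C - insert z (near C z)"
  show sub: "?D \<subseteq> C" by auto
  show "nbhd ?D e \<subseteq> nbhd C e" for e by (auto simp: nbhd_def)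
  fix e f assume e: "e \<in> ?D" "f \<in> ?D" "side e = s" "side f = s"
  have nz: "\<not> adj z e" "\<not> adj z f" using e by (auto simp: near_def)
  have "w \<in> ?D" if "w \<in> C" "adj e w" "\<not> adj f w" for w
  proof -
    have "w \<notin> near C z"
    proof
      assume w: "w \<in> near C z"
      show False
      proof (cases "side z = s")
        case True
        then have "adj z w" using adj_side[OF that(2)] e near_side[OF w] by auto
        then show False using that e adj_sym by (auto simp: near_def)
      next
        case False
        then have "side w = side z" using adj_side[OF that(2)] e by (intro other_side[of w e z]) auto
        then have "adj f w"
          using assms(2) e(2,4) nz(2) w False unfolding splitter_def by simp
        with that(3) show False by simp
      qed
    qed
    with that nz adj_sym show ?thesis by auto
  qed
  then show "nbhd ?D e - nbhd ?D f = nbhd C e - nbhd C f" by (auto simp: nbhd_def)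
qed

end

section \<open>Existence of a splitter by an exchange argument along a cycle\<close>

lemma finite_self_map_cycle:
  assumes "finite A" "A \<noteq> {}" "f ` A \<subseteq> A"
  obtains Z where "Z \<subseteq> A" "Z \<noteq> {}" "bij_betw f Z Z"
proof -
  \<comment> \<open>A minimal nonempty set that \<open>f\<close> maps into itself equals its image,
    since the image is again such a set.\<close>
  let ?S = "{Z. Z \<subseteq> A \<and> Z \<noteq> {} \<and> f ` Z \<subseteq> Z}"
  have "finite ?S" using \<open>finite A\<close> by (auto intro: finite_subset[of _ "Pow A"])
  moreover have "?S \<noteq> {}" using assms(2,3) by force
  ultimately have "\<exists>Z\<in>?S. \<forall>Y\<in>?S. Y \<subseteq> Z \<longrightarrow> Z = Y" by (rule finite_has_minimal)
  then obtain Z where Z: "Z \<in> ?S" "\<forall>Y\<in>?S. Y \<subseteq> Z \<longrightarrow> Z = Y" by (rule bexE)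
  from Z(1) have "f ` Z \<in> ?S" "f ` Z \<subseteq> Z" by auto
  then have "f ` Z = Z" using bspec[OF Z(2), of "f ` Z"] by simp
  moreover have "finite Z" using Z assms finite_subset by auto
  ultimately have "bij_betw f Z Z" by (simp add: bij_betw_def eq_card_imp_inj_on)
  with Z that show ?thesis by auto
qed

text \<open>If the vertex \<open>z\<close> had edges \<open>e z\<close>, \<open>f z\<close> as below for every \<open>z\<close>, then along a cycle \<open>Z\<close> of
  \<open>nx\<close> the indicator functions would satisfy \<open>\<Sum> f z \<le> \<Sum> e z\<close>. Restricting this to the complement
  of a largest \<open>e z\<close> gives a contradiction.\<close>

lemma no_cyclic_exchange:
  fixes e f :: "'v \<Rightarrow> 'v set"
  assumes "finite Z" "Z \<noteq> {}" "bij_betw nx Z Z"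
    and fin: "\<And>z. z \<in> Z \<Longrightarrow> finite (e z)" "\<And>z. z \<in> Z \<Longrightarrow> finite (f z)"
    and z: "\<And>z. z \<in> Z \<Longrightarrow> z \<in> e z - f z"
    and two: "\<And>z. z \<in> Z \<Longrightarrow> card (e z - f z) \<ge> 2"
    and one: "\<And>z. z \<in> Z \<Longrightarrow> f z - e z = {nx z}"
    and Sperner: "\<And>z y. z \<in> Z \<Longrightarrow> y \<in> Z \<Longrightarrow> f z \<noteq> e y \<Longrightarrow> \<not> f z \<subseteq> e y"
    and min1: "\<And>z y. z \<in> Z \<Longrightarrow> y \<in> Z \<Longrightarrow> card (e z - e y) \<le> 1 \<or> card (e y - e z) \<le> 1"
  shows False
proof -
  obtain y where y: "y \<in> Z" "\<And>z. z \<in> Z \<Longrightarrow> card (e z) \<le> card (e y)"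
    using Max_in[of "(\<lambda>z. card (e z)) ` Z"] Max_ge[of "(\<lambda>z. card (e z)) ` Z"] assms(1,2) by fastforce
  have split: "card X = card (X \<inter> Y) + card (X - Y)" if "finite X" for X Y :: "'v set"
    using card_Int_Diff that by blast
  have less: "card (f z) < card (e z)" if "z \<in> Z" for z
    using split[OF fin(2)[OF that], of "e z"] split[OF fin(1)[OF that], of "f z"]
      one[OF that] two[OF that] by (simp add: Int_commute[of "f z" "e z"])
  \<comment> \<open>\<open>f z\<close> is smaller than \<open>e z\<close>, hence smaller than the
    largest set \<open>e y\<close>. So the two differ, and the Sperner condition excludes
    containment.\<close>
  have f1: "1 \<le> card (f z - e y)" if "z \<in> Z" for z
  proof -
    have "f z \<noteq> e y" using less[OF that] y(2)[OF that] by auto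
    then have "f z - e y \<noteq> {}" using Sperner[OF that y(1)] by auto
    then show ?thesis using fin(2)[OF that] by (simp add: Suc_le_eq card_gt_0_iff)
  qed
  \<comment> \<open>As \<open>e z\<close> is no larger than \<open>e y\<close>, the difference
    \<open>e z - e y\<close> is the smaller of the two and hence the one bounded by 1.\<close>
  have e1: "card (e z - e y) \<le> 1" if "z \<in> Z" for z
    using min1[OF that y(1)] split[OF fin(1)[OF that], of "e y"]
      split[OF fin(1)[OF y(1)], of "e z"] y(2)[OF that]
    unfolding Int_commute[of "e y" "e z"] by linarith
  let ?b = "\<lambda>x. if x \<in> e y then 0 else 1 :: nat"
  have f2: "card (f z - e y) = card (f z \<inter> e z - e y) + ?b (nx z)" if "z \<in> Z" for z
  proof -
    have "f z - e y = (f z \<inter> e z - e y) \<union> ({nx z} - e y)" using one[OF that] by auto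
    moreover have "card ((f z \<inter> e z - e y) \<union> ({nx z} - e y)) = card (f z \<inter> e z - e y) + card ({nx z} - e y)"
      using one[OF that] fin that by (intro card_Un_disjoint) auto
    ultimately show ?thesis by (simp add: insert_Diff_if)
  qed
  have e2: "card (f z \<inter> e z - e y) + ?b z \<le> card (e z - e y)" if "z \<in> Z" for z
  proof -
    have "card (f z \<inter> e z - e y) + card ({z} - e y) = card ((f z \<inter> e z - e y) \<union> ({z} - e y))"
      using z[OF that] fin that by (intro card_Un_disjoint[symmetric]) auto
    also have "\<dots> \<le> card (e z - e y)"
      using z[OF that] fin that by (intro card_mono) auto
    finally show ?thesis by (cases "z \<in> e y") (simp_all add: insert_Diff_if)
  qed
  have "card Z = (\<Sum>z\<in>Z. 1)" by simp
  also have "\<dots> \<le> (\<Sum>z\<in>Z. card (f z - e y))" using f1 by (rule sum_mono)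
  also have "\<dots> = (\<Sum>z\<in>Z. card (f z \<inter> e z - e y)) + (\<Sum>z\<in>Z. ?b (nx z))"
    using f2 by (simp add: sum.distrib)
  also have "(\<Sum>z\<in>Z. ?b (nx z)) = (\<Sum>z\<in>Z. ?b z)"
    using sum.reindex_bij_betw[OF assms(3), of ?b] .
  also have "(\<Sum>z\<in>Z. card (f z \<inter> e z - e y)) + (\<Sum>z\<in>Z. ?b z) \<le> (\<Sum>z\<in>Z. card (e z - e y))"
    unfolding sum.distrib[symmetric] using e2 by (rule sum_mono)
  \<comment> \<open>Strict because the summand for \<open>y\<close> itself is 0.\<close>
  also have "\<dots> < (\<Sum>z\<in>Z. 1)"
    using assms(1) y(1) e1 by (intro sum_strict_mono_ex1) (auto intro!: bexI[of _ y])
  finally show False by simp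
qed

context bipartite_relation
begin

lemma splitter_exists:
  assumes "finite C" "C \<noteq> {}" and sp_side: "s = 1 \<or> s = 2" and sp: "one_Sperner s C"
  shows "\<exists>z. splitter C z"
proof (rule ccontr)
  assume no: "\<not> ?thesis"
  \<comment> \<open>An isolated vertex has an empty near part and is trivially a splitter. So the
    vertices exempt from the Sperner condition do not occur here.\<close>
  have ne: "nbhd C v \<noteq> {}" if "v \<in> C" for v
  proof
    assume "nbhd C v = {}"
    then have "near C v = {}" by (auto simp: near_def nbhd_def)
    with that no show False by (auto simp: splitter_def)
  qed
  define A where "A = {z \<in> C. side z \<noteq> s}"
  have "A \<noteq> {}"
  proof -
    obtain v where "v \<in> C" using assms by auto
    moreover obtain w where "w \<in> C" "adj v w" using ne[OF \<open>v \<in> C\<close>] by (auto simp: nbhd_def)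
    ultimately show ?thesis using adj_side[of v w] by (cases "side v = s") (auto simp: A_def)
  qed
  have sp1: "\<not> nbhd C e \<subseteq> nbhd C f"
    and sp2: "card (nbhd C e - nbhd C f) \<le> 1 \<or> card (nbhd C f - nbhd C e) \<le> 1"
    if "e \<in> C" "f \<in> C" "side e = s" "side f = s" "e \<noteq> f" for e f
    using sp that ne unfolding one_Sperner_def by blast+
  have fin: "finite (nbhd C v)" for v using assms(1) by (simp add: nbhd_def)
  have "\<exists>e f x. e \<in> C \<and> f \<in> C \<and> side e = s \<and> side f = s \<and> z \<in> nbhd C e - nbhd C f \<and>
      2 \<le> card (nbhd C e - nbhd C f) \<and> nbhd C f - nbhd C e = {x} \<and> x \<in> A" if "z \<in> A" for z
  proof -
    \<comment> \<open>\<open>f\<close> and \<open>w\<close> witness that \<open>z\<close> is not a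
      splitter, and \<open>e\<close> links \<open>z\<close> to \<open>w\<close>. Both
      \<open>z\<close> and \<open>w\<close> lie in \<open>e - f\<close>, so \<open>f - e\<close>
      must be a singleton; its element \<open>x\<close> is the successor of
      \<open>z\<close>.\<close>
    from that no obtain f w where f: "f \<in> C" "side f \<noteq> side z" "\<not> adj z f" "w \<in> near C z"
      "side w = side z" "\<not> adj f w" unfolding splitter_def A_def by blast
    then have "\<not> adj z w" using adj_side[of z w] by auto
    with f obtain e where e: "e \<in> C" "adj z e" "adj e w" "w \<noteq> z" "w \<in> C" unfolding near_def by auto
    have s: "side e = s" "side f = s"
      using that f(2) adj_side[OF e(2)] side_range[of e] side_range[of f] side_range[of z]
        sp_side unfolding A_def by auto
    have sub: "{z, w} \<subseteq> nbhd C e - nbhd C f"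
      using e f that adj_sym by (auto simp: nbhd_def A_def)
    have 2: "2 \<le> card (nbhd C e - nbhd C f)"
      using card_mono[OF _ sub] fin e(4) by auto
    have "e \<noteq> f" using e f by auto
    then have "card (nbhd C f - nbhd C e) \<le> 1" "\<not> nbhd C f \<subseteq> nbhd C e"
      using sp1[of f e] sp2[of e f] e f s 2 by auto
    then obtain x where x: "nbhd C f - nbhd C e = {x}"
      using fin by (metis Diff_eq_empty_iff card_1_singletonE card_0_eq finite_Diff le_Suc_eq le_zero_eq One_nat_def)
    then have "x \<in> nbhd C f" by auto
    then have "x \<in> A" using adj_side[of f x] s by (auto simp: A_def nbhd_def)
    with e f s sub 2 x show ?thesis by auto
  qed
  then obtain e f nx where *: "\<And>z. z \<in> A \<Longrightarrow> e z \<in> C \<and> f z \<in> C \<and> side (e z) = s \<and> side (f z) = s \<and>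
      z \<in> nbhd C (e z) - nbhd C (f z) \<and> 2 \<le> card (nbhd C (e z) - nbhd C (f z)) \<and>
      nbhd C (f z) - nbhd C (e z) = {nx z} \<and> nx z \<in> A"
    by metis
  have "finite A" using assms by (simp add: A_def)
  then obtain Z where Z: "Z \<subseteq> A" "Z \<noteq> {}" "bij_betw nx Z Z"
    using finite_self_map_cycle[of A nx] \<open>A \<noteq> {}\<close> * by blast
  show False
  proof (rule no_cyclic_exchange[of Z nx "\<lambda>z. nbhd C (e z)" "\<lambda>z. nbhd C (f z)"])
    show "finite Z" using Z \<open>finite A\<close> finite_subset by auto
    fix z assume "z \<in> Z"
    then show "2 \<le> card (nbhd C (e z) - nbhd C (f z))" "z \<in> nbhd C (e z) - nbhd C (f z)"
      "nbhd C (f z) - nbhd C (e z) = {nx z}"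
      using * Z by auto
    fix y assume "y \<in> Z"
    show "\<not> nbhd C (f z) \<subseteq> nbhd C (e y)" if "nbhd C (f z) \<noteq> nbhd C (e y)"
    proof (rule sp1)
      show "f z \<noteq> e y" using that by auto
    qed (use * Z \<open>z \<in> Z\<close> \<open>y \<in> Z\<close> in auto)
    show "card (nbhd C (e z) - nbhd C (e y)) \<le> 1 \<or> card (nbhd C (e y) - nbhd C (e z)) \<le> 1"
    proof (cases "e z = e y")
      case False then show ?thesis using sp2 * Z \<open>z \<in> Z\<close> \<open>y \<in> Z\<close> by blast
    qed simp
  qed (use Z fin in auto)
qed

end

section \<open>Expressions from splitters\<close>

definition graph_adj :: "'v graph \<Rightarrow> 'v \<Rightarrow> 'v \<Rightarrow> bool" where
  "graph_adj G u v \<longleftrightarrow> {u, v} \<in> edges G"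

definition edges_within :: "('v \<Rightarrow> 'v \<Rightarrow> bool) \<Rightarrow> 'v set \<Rightarrow> 'v set set" where
  "edges_within adj C = {{u, v} | u v. u \<in> C \<and> v \<in> C \<and> adj u v}"

context bipartite_relation
begin

text \<open>The sides serve as labels 1 and 2. While a class is assembled, the splitter has label 5 and
  the far part has labels 3 and 4.\<close>

definition builds :: "'v cw_expr \<Rightarrow> 'v set \<Rightarrow> bool" where
  "builds e C \<longleftrightarrow> k_expression 5 e \<and> verts (graph_of e) = C \<and>
     edges (graph_of e) = edges_within adj C \<and> (\<forall>v \<in> C. label (graph_of e) v = side v)"

abbreviation far :: "'v set \<Rightarrow> 'v \<Rightarrow> 'v set" where
  "far C z \<equiv> C - insert z (near C z)"

text \<open>The empty graph has no expression, so an empty part is a case of its own, in which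
  \<open>e\<close> is ignored. The label \<open>3 - side z\<close> is that of the opposite side,
  whose vertices in the near part are exactly the neighbours of \<open>z\<close>.\<close>

definition attach_near :: "'v set \<Rightarrow> 'v \<Rightarrow> 'v cw_expr \<Rightarrow> 'v cw_expr" where
  "attach_near C z e =
     (if near C z = {} then Create 5 z else Join 5 (3 - side z) (Union (Create 5 z) e))"

text \<open>After the far labels have been raised by 2, the side opposite to \<open>z\<close> has
  label \<open>5 - side z\<close> there. The join does not touch \<open>z\<close>, which still
  carries label 5.\<close>

definition attach_far :: "'v set \<Rightarrow> 'v \<Rightarrow> 'v cw_expr \<Rightarrow> 'v cw_expr \<Rightarrow> 'v cw_expr" where
  "attach_far C z e e' =
     (if far C z = {} then e
      else Relabel 4 2 (Relabel 3 1 (Join (side z) (5 - side z)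
             (Union e (Relabel 2 4 (Relabel 1 3 e'))))))"

definition combine :: "'v set \<Rightarrow> 'v \<Rightarrow> 'v cw_expr \<Rightarrow> 'v cw_expr \<Rightarrow> 'v cw_expr" where
  "combine C z e e' = Relabel 5 (side z) (attach_far C z (attach_near C z e) e')"

lemma adj_irrefl: "\<not> adj v v"
  using adj_side by blast

lemma side_12: "side v \<in> {1, 2}"
  using side_range by auto

lemma attach_near_graph:
  assumes z: "z \<in> C" and e: "near C z \<noteq> {} \<Longrightarrow> builds e (near C z)"
  shows "k_expression 5 (attach_near C z e)"
    and "verts (graph_of (attach_near C z e)) = insert z (near C z)"
    and "edges (graph_of (attach_near C z e)) = edges_within adj (insert z (near C z))"
    and "v \<in> insert z (near C z) \<Longrightarrow>
      label (graph_of (attach_near C z e)) v = (if v = z then 5 else side v)"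
proof -
  let ?a = "attach_near C z e"
  have "k_expression 5 ?a \<and> verts (graph_of ?a) = insert z (near C z) \<and>
      edges (graph_of ?a) = edges_within adj (insert z (near C z)) \<and>
      (\<forall>v \<in> insert z (near C z). label (graph_of ?a) v = (if v = z then 5 else side v))"
  proof (cases "near C z = {}")
    case True
    then show ?thesis using adj_irrefl by (auto simp: attach_near_def edges_within_def)
  next
    case False
    note b = e[OF False, unfolded builds_def]
    have opp: "side w = 3 - side z \<longleftrightarrow> adj z w" if "w \<in> near C z" for w
      using near_side[OF that] side_range[of z] side_range[of w] by auto
    have lab: "label (graph_of (Union (Create 5 z) e)) w = (if w = z then 5 else side w)"
      if "w \<in> insert z (near C z)" for w
      using that b by auto
    have "{{u, v} |u v. u \<in> insert z (near C z) \<and> v \<in> insert z (near C z) \<and>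
        (if u = z then 5 else side u) = 5 \<and> (if v = z then 5 else side v) = 3 - side z} =
        {{z, v} | v. v \<in> near C z \<and> adj z v}"
    proof -
      have 5: "side u \<noteq> 5" "3 - side u \<noteq> 5" for u using side_range[of u] by auto
      have "(\<exists>u v. X = {u, v} \<and> u \<in> insert z (near C z) \<and> v \<in> insert z (near C z) \<and>
        (if u = z then 5 else side u) = 5 \<and> (if v = z then 5 else side v) = 3 - side z) \<longleftrightarrow>
        (\<exists>v. X = {z, v} \<and> v \<in> near C z \<and> adj z v)" for X
        using 5 opp not_near_self[of z C] by (auto split: if_splits) metis+
      then show ?thesis by simp
    qed
    moreover have "edges_within adj (insert z (near C z)) =
        edges_within adj (near C z) \<union> {{z, v} | v. v \<in> near C z \<and> adj z v}"
      using adj_sym adj_irrefl by (auto simp: edges_within_def insert_commute)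
    ultimately show ?thesis
      using False b lab side_12[of z] not_near_self[of z C]
      by (auto simp: attach_near_def cong: conj_cong)
  qed
  then show "k_expression 5 ?a" "verts (graph_of ?a) = insert z (near C z)"
    "edges (graph_of ?a) = edges_within adj (insert z (near C z))"
    "v \<in> insert z (near C z) \<Longrightarrow> label (graph_of ?a) v = (if v = z then 5 else side v)"
    by auto
qed

lemma combine_builds:
  assumes z: "splitter C z"
    and e: "near C z \<noteq> {} \<Longrightarrow> builds e (near C z)"
    and e': "far C z \<noteq> {} \<Longrightarrow> builds e' (far C z)"
  shows "builds (combine C z e e') C"
proof -
  let ?a = "attach_near C z e" and ?N = "insert z (near C z)" and ?F = "far C z"
  have zC: "z \<in> C" using z by (simp add: splitter_def)
  note a = attach_near_graph[of z C e, OF zC e]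
  have CNF: "?N \<union> ?F = C" "?N \<inter> ?F = {}" using zC by (auto simp: near_def)
  have ne: "side u \<noteq> 0" "side u \<noteq> 3" "side u \<noteq> 4" "side u \<noteq> 5" for u
    using side_range[of u] by auto
  let ?b = "attach_far C z ?a e'"
  have "k_expression 5 ?b \<and> verts (graph_of ?b) = C \<and> edges (graph_of ?b) = edges_within adj C \<and>
      (\<forall>v \<in> C. label (graph_of ?b) v = (if v = z then 5 else side v))"
  proof (cases "?F = {}")
    case True
    then have "?N = C" using CNF by auto
    with True a show ?thesis by (auto simp: attach_far_def)
  next
    case False
    note b = e'[OF False, unfolded builds_def]
    define u where "u = Union ?a (Relabel 2 4 (Relabel 1 3 e'))"
    have lab: "label (graph_of u) v = (if v = z then 5 else if v \<in> near C z then side v else side v + 2)"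
      if "v \<in> C" for v
      using that a(2) a(4)[of v] b CNF side_range[of v] by (auto simp: u_def)
    have vu: "verts (graph_of u) = C" using a b CNF by (auto simp: u_def)
    have eu: "edges (graph_of u) = edges_within adj ?N \<union> edges_within adj ?F"
      using a b by (simp add: u_def)
    have ku: "k_expression 5 u" using a b CNF by (auto simp: u_def)
    have lab_s: "label (graph_of u) x = side z \<longleftrightarrow> x \<in> near C z \<and> side x = side z" if "x \<in> C" for x
      using lab[OF that] side_range[of z] side_range[of x] not_near_self[of z C] by auto
    have lab_o: "label (graph_of u) y = 5 - side z \<longleftrightarrow> y \<in> ?F \<and> side y \<noteq> side z" if "y \<in> C" for y
      using lab[OF that] that side_range[of z] side_range[of y] by auto
    let ?J = "{{x, y} | x y. x \<in> near C z \<and> side x = side z \<and> y \<in> ?F \<and> side y \<noteq> side z}"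
    have ej: "edges (graph_of (Join (side z) (5 - side z) u)) = edges_within adj C"
    proof -
      have J: "{{x, y} | x y. x \<in> C \<and> y \<in> C \<and> label (graph_of u) x = side z \<and>
          label (graph_of u) y = 5 - side z} = ?J"
        using lab_s lab_o by (auto simp: near_def) blast+
      have "?J \<subseteq> edges_within adj C"
      proof -
        \<comment> \<open>The join adds no wrong edge: this is exactly the splitting
          condition.\<close>
        have "adj x y" if "x \<in> near C z" "side x = side z" "y \<in> ?F" "side y \<noteq> side z" for x y
        proof -
          have "y \<in> C" "\<not> adj z y" using that by (auto simp: near_def)
          then have "adj y x" using z that by (simp add: splitter_def)
          then show ?thesis by (rule adj_sym)
        qed
        then show ?thesis unfolding edges_within_def near_def by blast
      qed
      moreover have "edges_within adj ?N \<union> edges_within adj ?F \<subseteq> edges_within adj C"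
        using CNF unfolding edges_within_def by blast
      moreover have "edges_within adj C \<subseteq> edges_within adj ?N \<union> edges_within adj ?F \<union> ?J"
      proof -
        \<comment> \<open>No other edges cross: \<open>z\<close> has no neighbour in the far part,
          and all neighbours of a neighbour of \<open>z\<close> are \<open>z\<close> or near. So
          \<open>x\<close> is a near vertex on the side of \<open>z\<close>.\<close>
        have *: "{x, y} \<in> ?J" if "x \<in> ?N" "y \<in> ?F" "adj x y" for x y
        proof -
          have "\<not> adj z y" "y \<noteq> z" using that by (auto simp: near_def)
          then have x: "x \<in> near C z" using that by auto
          then have "\<not> adj z x" using that(2,3) by (auto simp: near_def)
          then have "side x = side z" using near_side[OF x] by simp
          moreover from this have "side y \<noteq> side z" using adj_side[OF that(3)] by simp
          ultimately show ?thesis using x that(2) by blast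
        qed
        show ?thesis
        proof
          fix X assume "X \<in> edges_within adj C"
          then obtain x y where X: "X = {x, y}" "x \<in> C" "y \<in> C" "adj x y"
            unfolding edges_within_def by blast
          consider "x \<in> ?N" "y \<in> ?N" | "x \<in> ?F" "y \<in> ?F" | "x \<in> ?N" "y \<in> ?F" | "x \<in> ?F" "y \<in> ?N"
            using X CNF by blast
          then show "X \<in> edges_within adj ?N \<union> edges_within adj ?F \<union> ?J"
          proof cases
            case 3 then show ?thesis using *[of x y] X by simp
          next
            case 4 then show ?thesis using *[of y x] X adj_sym[of x y] by (simp add: insert_commute)
          qed (use X in \<open>auto simp: edges_within_def\<close>)
        qed
      qed
      ultimately show ?thesis using J by (simp add: eu vu) blast
    qed
    have "attach_far C z ?a e' = Relabel 4 2 (Relabel 3 1 (Join (side z) (5 - side z) u))"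
      using False by (simp add: attach_far_def u_def)
    moreover have "k_expression 5 (Join (side z) (5 - side z) u)"
      using ku side_range[of z] by auto
    moreover have "label (graph_of (Relabel 4 2 (Relabel 3 1 (Join (side z) (5 - side z) u)))) v =
        (if v = z then 5 else side v)" if "v \<in> C" for v
      using lab[OF that] side_range[of v] by auto
    ultimately show ?thesis using ej vu by simp
  qed
  then show ?thesis
    using ne side_12[of z] by (auto simp: builds_def combine_def)
qed

end

lemma has_induced_two_P3:
  assumes "{a, b, c, d, e, f} \<subseteq> verts G" "distinct [a, b, c, d, e, f]"
    and "graph_adj G a b" "graph_adj G b c" "graph_adj G d e" "graph_adj G e f"
    and "\<And>v. \<not> graph_adj G v v"
    and "\<not> graph_adj G a c" "\<not> graph_adj G d f"
    and "\<And>x y. x \<in> {a, b, c} \<Longrightarrow> y \<in> {d, e, f} \<Longrightarrow> \<not> graph_adj G x y"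
  shows "has_induced G two_P3"
proof -
  define h :: "'a \<Rightarrow> nat" where
    "h x = (if x = a then 0 else if x = b then 1 else if x = c then 2 else if x = d then 3
      else if x = e then 4 else 5)" for x
  let ?S = "{a, b, c, d, e, f}"
  have h: "h a = 0" "h b = 1" "h c = 2" "h d = 3" "h e = 4" "h f = 5"
    using assms(2) by (auto simp: h_def)
  have bij: "bij_betw h ?S (verts two_P3)"
    using assms(2) h by (auto simp: bij_betw_def two_P3_def inj_on_def)
  have sym: "{x, y} \<in> edges G \<longleftrightarrow> {y, x} \<in> edges G" for x y by (simp add: insert_commute)
  have "{x, y} \<in> edges (induced_subgraph G ?S) \<longleftrightarrow> {h x, h y} \<in> edges two_P3"
    if "x \<in> ?S" "y \<in> ?S" for x y
  proof -
    have "{x, y} \<in> edges (induced_subgraph G ?S) \<longleftrightarrow> {x, y} \<in> edges G"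
      using that by (simp add: induced_subgraph_def)
    moreover have "{x, y} \<in> edges G \<longleftrightarrow> {h x, h y} \<in> edges two_P3"
      using that assms(3-) unfolding insert_iff empty_iff graph_adj_def
      by (elim disjE; simp add: h two_P3_def doubleton_eq_iff sym)
    ultimately show ?thesis by simp
  qed
  then have "graph_iso (induced_subgraph G ?S) two_P3"
    using bij unfolding graph_iso_def by (intro exI[of _ h]) (simp add: induced_subgraph_def)
  then show ?thesis using assms(1) unfolding has_induced_def by blast
qed

section \<open>Consequences of excluding two paths\<close>

lemma obtain_two_elements:
  assumes "\<not> card X \<le> 1" obtains x y where "x \<in> X" "y \<in> X" "x \<noteq> y"
proof -
  have "2 \<le> card X" using assms by simp
  then obtain Y where "Y \<subseteq> X" "card Y = 2" by (meson obtain_subset_with_card_n)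
  then show thesis using that by (auto simp: card_2_iff)
qed

text \<open>The bipartition need not be the one witnessing right-Spernerness: if inclusions occurred between
  nonisolated vertices on both of its sides, each of them would give a \<open>P\<^sub>3\<close> with both ends on the
  left of the witnessing bipartition, and these two paths would form a \<open>2P\<^sub>3\<close>.\<close>

lemma one_Sperner_bipartition:
  fixes G :: "'v graph"
  assumes "bipartite_relation (graph_adj G) side" and simple: "simple_graph G"
    and free: "\<not> has_induced G two_P3" and "right_Sperner G"
  shows "bipartite_relation.one_Sperner (graph_adj G) side 1 (verts G) \<or>
    bipartite_relation.one_Sperner (graph_adj G) side 2 (verts G)"
proof (rule ccontr)
  interpret bipartite_relation "graph_adj G" side by fact
  let ?N = "nbhd (verts G)"
  have V: "u \<in> verts G" "v \<in> verts G" if "graph_adj G u v" for u v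
    using simple that by (auto simp: simple_graph_def graph_adj_def)
  have irrefl: "\<not> graph_adj G v v" for v by (rule adj_irrefl)
  have same: "\<not> graph_adj G u v" if "side u = side v" for u v using that adj_side by blast
  \<comment> \<open>A violation always comes from an inclusion: two differences with two points each
    would form an induced \<open>two_P3\<close> with centres \<open>e\<close> and
    \<open>f\<close>.\<close>
  have inclusion: "\<exists>e f x. e \<noteq> f \<and> side e = s \<and> side f = s \<and> graph_adj G e x \<and> graph_adj G f x \<and> ?N e \<subseteq> ?N f"
    if not_Sperner: "\<not> one_Sperner s (verts G)" for s
  proof -
    from not_Sperner obtain e f where ef: "e \<in> verts G" "f \<in> verts G" "side e = s" "side f = s" "e \<noteq> f"
      "?N e \<noteq> {}" and
      "?N e \<subseteq> ?N f \<or> \<not> card (?N e - ?N f) \<le> 1 \<and> \<not> card (?N f - ?N e) \<le> 1"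
      unfolding one_Sperner_def by blast
    then consider "?N e \<subseteq> ?N f" | "\<not> card (?N e - ?N f) \<le> 1" "\<not> card (?N f - ?N e) \<le> 1" by blast
    then show ?thesis
    proof cases
      case 1
      with ef show ?thesis unfolding nbhd_def by blast
    next
      case 2
      obtain a c where ac: "a \<in> ?N e - ?N f" "c \<in> ?N e - ?N f" "a \<noteq> c"
        using obtain_two_elements[OF 2(1)] by metis
      obtain b d where bd: "b \<in> ?N f - ?N e" "d \<in> ?N f - ?N e" "b \<noteq> d"
        using obtain_two_elements[OF 2(2)] by metis
      have adj: "graph_adj G e a" "graph_adj G e c" "graph_adj G f b" "graph_adj G f d"
        and nadj: "\<not> graph_adj G e b" "\<not> graph_adj G e d" "\<not> graph_adj G f a" "\<not> graph_adj G f c"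
        using ac bd by (auto simp: nbhd_def)
      have side: "side a \<noteq> s" "side b \<noteq> s" "side c \<noteq> s" "side d \<noteq> s"
        using adj ef adj_side by blast+
      have side': "side a = side b" "side c = side b" "side d = side b"
        using other_side side ef(3) by metis+
      have "has_induced G two_P3"
      proof (rule has_induced_two_P3[of a e c b f d])
        show "{a, e, c, b, f, d} \<subseteq> verts G" using V adj by blast
        show "distinct [a, e, c, b, f, d]" using ac bd ef side by auto
        show "graph_adj G a e" "graph_adj G e c" "graph_adj G b f" "graph_adj G f d"
          using adj adj_sym by blast+
        show "\<not> graph_adj G x y" if "x \<in> {a, e, c}" "y \<in> {b, f, d}" for x y
          using that nadj adj_sym[of x y] same[of x y] side' ef(3,4) by auto
      qed (use same side' irrefl in auto)
      with free show ?thesis by simp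
    qed
  qed
  assume "\<not> ?thesis"
  then obtain e f x g h y where
    ef: "e \<noteq> f" "side e = 1" "side f = 1" "graph_adj G e x" "graph_adj G f x" "?N e \<subseteq> ?N f" and
    gh: "g \<noteq> h" "side g = 2" "side h = 2" "graph_adj G g y" "graph_adj G h y" "?N g \<subseteq> ?N h"
    using inclusion by metis
  obtain A B where AB: "bipartition G A B"
    and Sp: "\<And>u v. u \<in> B \<Longrightarrow> v \<in> B \<Longrightarrow> neighbours G u \<subseteq> neighbours G v \<Longrightarrow> u = v"
    using assms(4) unfolding right_Sperner_def by blast
  have AB1: "(u \<in> A \<and> v \<in> B) \<or> (u \<in> B \<and> v \<in> A)" if "graph_adj G u v" for u v
    using AB V[OF that] that unfolding bipartition_def independent_def graph_adj_def by blast
  \<comment> \<open>Vertices with nested neighbourhoods cannot both lie in the Sperner side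
    \<open>B\<close>, and a common neighbour puts them on the same side.\<close>
  have in_A: "u \<in> A" "v \<in> A" "w \<in> B"
    if "u \<noteq> v" "graph_adj G u w" "graph_adj G v w" "?N u \<subseteq> ?N v" for u v w
  proof -
    have nb: "neighbours G u = ?N u" for u
      using V adj_sym unfolding neighbours_def nbhd_def graph_adj_def by auto
    have "\<not> (u \<in> B \<and> v \<in> B)" using Sp[of u v] that unfolding nb by blast
    then show "u \<in> A" "v \<in> A" "w \<in> B"
      using AB1[OF that(2)] AB1[OF that(3)] AB unfolding bipartition_def by blast+
  qed
  have A: "e \<in> A" "f \<in> A" "x \<in> B" "g \<in> A" "h \<in> A" "y \<in> B"
    using in_A[OF ef(1,4,5,6)] in_A[OF gh(1,4,5,6)] by auto
  have nA: "\<not> graph_adj G u v" if "u \<in> A \<and> v \<in> A \<or> u \<in> B \<and> v \<in> B" for u v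
    using that AB by (auto simp: bipartition_def independent_def graph_adj_def)
  have xy: "side x = 2" "side y = 1"
    using adj_side[OF ef(4)] adj_side[OF gh(4)] ef gh side_range[of x] side_range[of y] by auto
  have "has_induced G two_P3"
  proof (rule has_induced_two_P3[of e x f g y h])
    show "{e, x, f, g, y, h} \<subseteq> verts G" using V ef gh by blast
    have "x \<noteq> g" "x \<noteq> h" "y \<noteq> e" "y \<noteq> f" using A AB by (auto simp: bipartition_def)
    then show "distinct [e, x, f, g, y, h]" using ef gh xy by auto
    show "graph_adj G e x" "graph_adj G x f" "graph_adj G g y" "graph_adj G y h"
      using ef gh adj_sym by blast+
    \<comment> \<open>Two ends are both in \<open>A\<close> and the two centres both in
      \<open>B\<close>; an end of one path and the centre of the other have the same
      \<open>side\<close>.\<close>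
    show "\<not> graph_adj G u v" if "u \<in> {e, x, f}" "v \<in> {g, y, h}" for u v
      using that same[of u v] nA[of u v] A xy ef gh by auto
  qed (use nA A irrefl in auto)
  with free show False by simp
qed

text \<open>The program and the expressions in \<open>clique_width\<close> use natural numbers as
  vertices. This transports an arbitrary graph, with all hypotheses, to the vertex set on which the
  program works.\<close>

lemma nat_copy:
  fixes G :: "'a graph"
  assumes "simple_graph G"
  obtains G' :: "nat graph" where "verts G' = {..<card (verts G)}" "simple_graph G'" "graph_iso G' G"
    "bipartite G \<Longrightarrow> bipartite G'" "right_Sperner G \<Longrightarrow> right_Sperner G'"
    "\<And>H :: nat graph. has_induced G' H \<Longrightarrow> has_induced G H"
proof -
  let ?n = "card (verts G)"
  have "finite (verts G)" using assms by (simp add: simple_graph_def)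
  then obtain g where g: "bij_betw g {..<?n} (verts G)"
    using ex_bij_betw_nat_finite atLeast0LessThan by metis
  have gV: "g i \<in> verts G" if "i < ?n" for i using g that by (auto simp: bij_betw_def)
  have g_inj: "i = j" if "g i = g j" "i < ?n" "j < ?n" for i j
    using g that by (auto simp: bij_betw_def inj_on_def)
  have g_surj: "\<exists>i<?n. g i = v" if "v \<in> verts G" for v
    using g that unfolding bij_betw_def by (metis imageE lessThan_iff)
  define G' :: "nat graph" where
    "G' = \<lparr>verts = {..<?n}, edges = {{i, j} | i j. i < ?n \<and> j < ?n \<and> {g i, g j} \<in> edges G}\<rparr>"
  have V': "verts G' = {..<?n}" by (simp add: G'_def)
  have E': "{i, j} \<in> edges G' \<longleftrightarrow> i < ?n \<and> j < ?n \<and> {g i, g j} \<in> edges G" for i j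
    unfolding G'_def by (auto simp: doubleton_eq_iff insert_commute)
  have EV: "u \<in> verts G" if "{u, v} \<in> edges G" for u v
    using assms that by (auto simp: simple_graph_def)
  have irrefl: "{v} \<notin> edges G" for v using assms by (auto simp: simple_graph_def)
  have "card X = 2 \<and> X \<subseteq> {..<?n}" if "X \<in> edges G'" for X
  proof -
    from that obtain i j where ij: "X = {i, j}" "i < ?n" "j < ?n" "{g i, g j} \<in> edges G"
      unfolding G'_def by auto
    then have "i \<noteq> j" using irrefl[of "g i"] by auto
    with ij show ?thesis by simp
  qed
  then have simple: "simple_graph G'" unfolding simple_graph_def V' by auto
  have iso: "graph_iso G' G"
    unfolding graph_iso_def V' using g E' by (intro exI[of _ g]) auto
  have part: "bipartition G' {i. i < ?n \<and> g i \<in> A} {i. i < ?n \<and> g i \<in> B}" if "bipartition G A B" for A B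
    using that gV unfolding bipartition_def independent_def V' E' by auto
  have Sp: "right_Sperner G'" if "right_Sperner G"
  proof -
    from that obtain A B where AB: "bipartition G A B"
      "\<forall>u\<in>B. \<forall>v\<in>B. neighbours G u \<subseteq> neighbours G v \<longrightarrow> u = v" unfolding right_Sperner_def by blast
    have "i = j" if ij: "i < ?n" "g i \<in> B" "j < ?n" "g j \<in> B" "neighbours G' i \<subseteq> neighbours G' j" for i j
    proof -
      have "neighbours G (g i) \<subseteq> neighbours G (g j)"
      proof
        fix w assume w: "w \<in> neighbours G (g i)"
        then have "w \<in> verts G" using EV unfolding neighbours_def by blast
        then obtain k where "k < ?n" "g k = w" using g_surj by blast
        then have "k \<in> neighbours G' i" using w ij by (simp add: neighbours_def E')
        then have "k \<in> neighbours G' j" using ij by blast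
        then show "w \<in> neighbours G (g j)" using \<open>g k = w\<close> by (simp add: neighbours_def E')
      qed
      then have "g i = g j" using AB(2) ij by blast
      then show ?thesis using g_inj ij by blast
    qed
    with part[OF AB(1)] show ?thesis unfolding right_Sperner_def by blast
  qed
  have ind: "has_induced G H" if "has_induced G' H" for H :: "nat graph"
  proof -
    from that obtain S f where S: "S \<subseteq> {..<?n}" "bij_betw f S (verts H)"
      and f: "\<And>u v. u \<in> S \<Longrightarrow> v \<in> S \<Longrightarrow> {u, v} \<in> edges G' \<longleftrightarrow> {f u, f v} \<in> edges H"
      unfolding has_induced_def graph_iso_def induced_subgraph_def V' by auto
    let ?h = "inv_into {..<?n} g"
    have gS: "bij_betw g S (g ` S)" using bij_betw_subset[OF g S(1)] by blast
    have h: "?h (g i) = i" if "i \<in> S" for i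
      using that S(1) g by (auto simp: bij_betw_def inv_into_f_f)
    have "bij_betw ?h (g ` S) S"
      using h by (intro bij_betw_byWitness[where f' = g]) auto
    then have "bij_betw (f \<circ> ?h) (g ` S) (verts H)" using S(2) by (rule bij_betw_trans)
    moreover have "{u, v} \<in> edges G \<longleftrightarrow> {f (?h u), f (?h v)} \<in> edges H" if "u \<in> g ` S" "v \<in> g ` S" for u v
    proof -
      from that obtain i j where ij: "i \<in> S" "u = g i" "j \<in> S" "v = g j" by blast
      then show ?thesis using f[of i j] S(1) by (auto simp: h E')
    qed
    moreover have "g ` S \<subseteq> verts G" using S(1) gV by auto
    ultimately show ?thesis
      unfolding has_induced_def graph_iso_def induced_subgraph_def
      by (intro exI[of _ "g ` S"] conjI exI[of _ "f \<circ> ?h"]) auto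
  qed
  show thesis
    using that[OF V' simple iso _ Sp ind] part unfolding bipartite_def by blast
qed

section \<open>Programs whose loops run from 0 to n\<close>

text \<open>The number of rounds of each loop is the fixed content of register 0. So these programs
  have a total semantics and a cost bound depending on \<open>n\<close> alone; only the main loop of
  the algorithm is a genuine \<open>While\<close>.\<close>

datatype lprog =
    LSkip
  | LAssign nat aexp
  | LStore nat aexp aexp
  | LSeq lprog lprog  (infixr ";;" 60)
  | LIf bexp lprog lprog
  | LFor nat lprog

primrec compile :: "lprog \<Rightarrow> com" where
  "compile LSkip = Skip"
| "compile (LAssign x a) = Assign x a"
| "compile (LStore m i a) = Store m i a"
| "compile (p ;; q) = Seq (compile p) (compile q)"
| "compile (LIf b p q) = If b (compile p) (compile q)"
| "compile (LFor x p) = Seq (Assign x (Const 0))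
     (While (Less (Reg x) (Reg 0)) (Seq (compile p) (Assign x (Plus (Reg x) (Const 1)))))"

definition set_reg :: "nat \<Rightarrow> nat \<Rightarrow> state \<Rightarrow> state" where
  "set_reg x v s = s\<lparr>reg := (reg s)(x := v)\<rparr>"

definition set_arr :: "nat \<Rightarrow> nat \<Rightarrow> nat \<Rightarrow> state \<Rightarrow> state" where
  "set_arr m i v s = s\<lparr>arr := (arr s)(m := (arr s m)(i := v))\<rparr>"

lemma set_simps [simp]:
  "reg (set_reg x v s) = (reg s)(x := v)" "arr (set_reg x v s) = arr s"
  "reg (set_arr m i v s) = reg s" "arr (set_arr m i v s) = (arr s)(m := (arr s m)(i := v))"
  by (simp_all add: set_reg_def set_arr_def)

text \<open>In \<open>LFor x p\<close>, the counter \<open>x\<close> runs from 0 up to the content of register 0, and \<open>sem\<close> is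
  faithful to the compiled program only if the body leaves both registers alone.\<close>

primrec sem :: "lprog \<Rightarrow> state \<Rightarrow> state" where
  "sem LSkip s = s"
| "sem (LAssign x a) s = set_reg x (aval a s) s"
| "sem (LStore m i a) s = set_arr m (aval i s) (aval a s) s"
| "sem (p ;; q) s = sem q (sem p s)"
| "sem (LIf b p q) s = (if bval b s then sem p s else sem q s)"
| "sem (LFor x p) s =
     ((\<lambda>s. set_reg x (Suc (reg s x)) (sem p s)) ^^ reg s 0) (set_reg x 0 s)"

primrec writes :: "lprog \<Rightarrow> nat set" where
  "writes LSkip = {}"
| "writes (LAssign x a) = {x}"
| "writes (LStore m i a) = {}"
| "writes (p ;; q) = writes p \<union> writes q"
| "writes (LIf b p q) = writes p \<union> writes q"
| "writes (LFor x p) = insert x (writes p)"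

primrec stores :: "lprog \<Rightarrow> nat set" where
  "stores LSkip = {}"
| "stores (LAssign x a) = {}"
| "stores (LStore m i a) = {m}"
| "stores (p ;; q) = stores p \<union> stores q"
| "stores (LIf b p q) = stores p \<union> stores q"
| "stores (LFor x p) = stores p"

primrec well_formed :: "lprog \<Rightarrow> bool" where
  "well_formed LSkip \<longleftrightarrow> True"
| "well_formed (LAssign x a) \<longleftrightarrow> True"
| "well_formed (LStore m i a) \<longleftrightarrow> True"
| "well_formed (p ;; q) \<longleftrightarrow> well_formed p \<and> well_formed q"
| "well_formed (LIf b p q) \<longleftrightarrow> well_formed p \<and> well_formed q"
| "well_formed (LFor x p) \<longleftrightarrow> well_formed p \<and> x \<noteq> 0 \<and> x \<notin> writes p \<and> 0 \<notin> writes p"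

text \<open>Adding both branches of a conditional instead of taking their maximum keeps the bound a
  polynomial in \<open>n\<close>. For a loop, 6 pays for the initial assignment (2) and the failing
  test (4), and 8 for the test (4) and the increment (4) of each round.\<close>

primrec cost :: "nat \<Rightarrow> lprog \<Rightarrow> nat" where
  "cost n LSkip = 1"
| "cost n (LAssign x a) = acost a + 1"
| "cost n (LStore m i a) = acost i + acost a + 1"
| "cost n (p ;; q) = cost n p + cost n q"
| "cost n (LIf b p q) = bcost b + 1 + (cost n p + cost n q)"
| "cost n (LFor x p) = 6 + n * (cost n p + 8)"

lemma sem_frame:
  "x \<notin> writes p \<Longrightarrow> reg (sem p s) x = reg s x"
  "m \<notin> stores p \<Longrightarrow> arr (sem p s) m = arr s m"
proof (induction p arbitrary: s)
  case (LFor y p)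
  let ?f = "\<lambda>s. set_reg y (Suc (reg s y)) (sem p s)"
  {
    case 1
    have "reg ((?f ^^ k) t) x = reg t x" for k t
      using 1 LFor(1) by (induction k) auto
    then show ?case using 1 by simp
  next
    case 2
    have "arr ((?f ^^ k) t) m = arr t m" for k t
      using 2 LFor(2) by (induction k) auto
    then show ?case by simp
  }
qed auto

text \<open>The proof of the step receives the frame conditions for free, so the invariant
  \<open>I\<close> need only describe what the body changes. It is required to hold again after the
  counter has been advanced.\<close>

lemma sem_LFor:
  assumes wf: "well_formed (LFor x p)" and n: "reg s 0 = n"
    and init: "I 0 (set_reg x 0 s)"
    and step: "\<And>k t. k < n \<Longrightarrow> reg t x = k \<Longrightarrow>
      (\<And>y. y \<notin> insert x (writes p) \<Longrightarrow> reg t y = reg s y) \<Longrightarrow>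
      (\<And>m. m \<notin> stores p \<Longrightarrow> arr t m = arr s m) \<Longrightarrow> I k t \<Longrightarrow>
      I (Suc k) (set_reg x (Suc k) (sem p t))"
  shows "I n (sem (LFor x p) s)"
proof -
  let ?f = "\<lambda>s. set_reg x (Suc (reg s x)) (sem p s)"
  have "k \<le> n \<Longrightarrow> reg ((?f ^^ k) (set_reg x 0 s)) x = k \<and>
      (\<forall>y. y \<notin> insert x (writes p) \<longrightarrow> reg ((?f ^^ k) (set_reg x 0 s)) y = reg s y) \<and>
      (\<forall>m. m \<notin> stores p \<longrightarrow> arr ((?f ^^ k) (set_reg x 0 s)) m = arr s m) \<and>
      I k ((?f ^^ k) (set_reg x 0 s))" for k
  proof (induction k)
    case 0
    then show ?case using init by simp
  next
    case (Suc k)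
    then show ?case using step[of k "(?f ^^ k) (set_reg x 0 s)"] by (simp add: sem_frame)
  qed
  from this[of n] show ?thesis by (simp add: n)
qed

lemma exec_compile:
  "well_formed p \<Longrightarrow> reg s 0 = n \<Longrightarrow> 0 \<notin> writes p \<Longrightarrow>
    \<exists>t. exec (compile p) s t (sem p s) \<and> t \<le> cost n p"
proof (induction p arbitrary: s)
  case LSkip
  show ?case by (auto intro: exec.intros)
next
  case (LAssign x a)
  show ?case by (auto simp: set_reg_def intro: exec.Assign)
next
  case (LStore m i a)
  show ?case by (auto simp: set_arr_def intro: exec.Store)
next
  case (LSeq p q)
  obtain t where t: "exec (compile p) s t (sem p s)" "t \<le> cost n p" using LSeq by auto
  have "reg (sem p s) 0 = n" using LSeq.prems by (simp add: sem_frame)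
  then obtain u where u: "exec (compile q) (sem p s) u (sem q (sem p s))" "u \<le> cost n q"
    using LSeq by auto
  show ?case using exec.Seq[OF t(1) u(1)] t(2) u(2) by (auto intro: add_mono)
next
  case (LIf b p q)
  obtain t where t: "exec (compile p) s t (sem p s)" "t \<le> cost n p" using LIf by auto
  obtain u where u: "exec (compile q) s u (sem q s)" "u \<le> cost n q" using LIf by auto
  show ?case
  proof (cases "bval b s")
    case True
    show ?thesis using exec.IfTrue[OF True t(1), of "compile q"] t(2) True
      by (auto intro!: exI[of _ "bcost b + 1 + t"])
  next
    case False
    show ?thesis using exec.IfFalse[OF False u(1), of "compile p"] u(2) False
      by (auto intro!: exI[of _ "bcost b + 1 + u"])
  qed
next
  case (LFor x p)
  let ?f = "\<lambda>s. set_reg x (Suc (reg s x)) (sem p s)"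
  let ?w = "While (Less (Reg x) (Reg 0)) (Seq (compile p) (Assign x (Plus (Reg x) (Const 1))))"
  have wf: "well_formed p" "x \<noteq> 0" "x \<notin> writes p" "0 \<notin> writes p" using LFor.prems by auto
  have loop: "\<exists>u. exec ?w s u ((?f ^^ k) s) \<and> u \<le> 4 + k * (cost n p + 8)"
    if "reg s 0 = n" "reg s x + k = n" for k s
    using that
  proof (induction k arbitrary: s)
    case 0
    then have "exec ?w s (bcost (Less (Reg x) (Reg 0)) + 1) s" by (intro exec.WhileFalse) simp
    then show ?case by (intro exI[of _ "bcost (Less (Reg x) (Reg 0)) + 1"]) simp
  next
    case (Suc k)
    obtain t where t: "exec (compile p) s t (sem p s)" "t \<le> cost n p"
      using LFor.IH[OF wf(1) Suc.prems(1) wf(4)] by auto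
    have "exec (Seq (compile p) (Assign x (Plus (Reg x) (Const 1)))) s (t + 4) (?f s)"
      using exec.Seq[OF t(1) exec.Assign[of x "Plus (Reg x) (Const 1)"]] wf
      by (simp add: set_reg_def sem_frame numeral_eq_Suc)
    moreover obtain u where u: "exec ?w (?f s) u ((?f ^^ k) (?f s))" "u \<le> 4 + k * (cost n p + 8)"
      using Suc.IH[of "?f s"] Suc.prems wf by (auto simp: sem_frame)
    ultimately have "exec ?w s (3 + 1 + (t + 4) + u) ((?f ^^ k) (?f s))"
      using exec.WhileTrue[of "Less (Reg x) (Reg 0)" s _ "t + 4" "?f s" u] Suc.prems by simp
    then show ?case unfolding funpow_Suc_right o_apply
      using t u by (intro exI[of _ "3 + 1 + (t + 4) + u"]) simp
  qed
  obtain u where u: "exec ?w (set_reg x 0 s) u ((?f ^^ n) (set_reg x 0 s))" "u \<le> 4 + n * (cost n p + 8)"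
    using loop[of "set_reg x 0 s" n] LFor.prems by auto
  have "exec (Assign x (Const 0)) s 2 (set_reg x 0 s)"
    using exec.Assign[of x "Const 0" s] by (simp add: set_reg_def numeral_2_eq_2)
  from exec.Seq[OF this u(1)] have "exec (compile (LFor x p)) s (2 + u) (sem (LFor x p) s)"
    using LFor.prems by simp
  then show ?case using u(2) by (intro exI[of _ "2 + u"]) simp
qed

declare sem.simps(6) [simp del]

section \<open>Arrays with a length register, read as lists\<close>

primrec append_all :: "nat \<Rightarrow> nat \<Rightarrow> aexp list \<Rightarrow> lprog" where
  "append_all m r [] = LSkip"
| "append_all m r (a # as) =
     LStore m (Reg r) a ;; LAssign r (Plus (Reg r) (Const 1)) ;; append_all m r as"

text \<open>With array 1 and register 1 this is \<open>output_of\<close>; with array 7 and register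
  12 it is the stack, whose top is the last element.\<close>

definition contents :: "nat \<Rightarrow> nat \<Rightarrow> state \<Rightarrow> nat list" where
  "contents m r s = map (arr s m) [0..<reg s r]"

lemma append_all_syntax [simp]:
  "well_formed (append_all m r as)"
  "writes (append_all m r as) = (if as = [] then {} else {r})"
  "stores (append_all m r as) = (if as = [] then {} else {m})"
  by (induction as) auto

text \<open>The hypothesis says that the items depend neither on register \<open>r\<close> nor on
  any array, so appending one item does not alter the values of the later ones.\<close>

lemma contents_append_all:
  assumes "\<And>a t. a \<in> set as \<Longrightarrow> (\<And>y. y \<noteq> r \<Longrightarrow> reg t y = reg s y) \<Longrightarrow> aval a t = aval a s"
  shows "contents m r (sem (append_all m r as) s) = contents m r s @ map (\<lambda>a. aval a s) as"
  using assms
proof (induction as arbitrary: s)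
  case (Cons a as)
  let ?s = "set_reg r (reg s r + 1) (set_arr m (reg s r) (aval a s) s)"
  have same: "aval b t = aval b s"
    if "b \<in> set (a # as)" "\<And>y. y \<noteq> r \<Longrightarrow> reg t y = reg s y" for b t
    using Cons.prems that by blast
  have "aval b t = aval b ?s"
    if "b \<in> set as" "\<And>y. y \<noteq> r \<Longrightarrow> reg t y = reg ?s y" for b t
    using same[of b t] same[of b ?s] that by simp
  then have "contents m r (sem (append_all m r as) ?s) = contents m r ?s @ map (\<lambda>a. aval a ?s) as"
    by (rule Cons.IH)
  moreover have "map (\<lambda>a. aval a ?s) as = map (\<lambda>a. aval a s) as"
    using same[of _ ?s] by simp
  moreover have "contents m r ?s = contents m r s @ [aval a s]"
    by (simp add: contents_def)
  ultimately show ?case by simp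
qed simp

section \<open>Computing a bipartition\<close>

text \<open>Array 2 holds the row offsets of the adjacency matrix, as the machine cannot multiply; array 3
  the sides; array 4 component names, which are merged along the edges while the sides of one of
  the two components are swapped if necessary; array 5 the marks of the near part; array 6 the
  class of each vertex, 0 if the vertex has been output; array 7 the stack of pending output.
  Register 10 holds the current class, 11 the next unused class name, 12 the height of the stack.\<close>

abbreviation adj_exp :: "nat \<Rightarrow> nat \<Rightarrow> aexp" where
  "adj_exp u v \<equiv> Arr 0 (Plus (Arr 2 (Reg u)) (Reg v))"

definition loads :: "nat \<Rightarrow> (nat \<Rightarrow> nat \<Rightarrow> bool) \<Rightarrow> state \<Rightarrow> bool" where
  "loads n adj s \<longleftrightarrow> reg s 0 = n \<and>
     (\<forall>u<n. \<forall>v<n. arr s 0 (arr s 2 u + v) = (if adj u v then 1 else 0))"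

lemma loadsD:
  assumes "loads n adj s"
  shows "reg s 0 = n" "u < n \<Longrightarrow> v < n \<Longrightarrow> arr s 0 (arr s 2 u + v) = (if adj u v then 1 else 0)"
  using assms by (auto simp: loads_def)

lemma loads_cong:
  "loads n adj s \<Longrightarrow> reg t 0 = reg s 0 \<Longrightarrow> arr t 0 = arr s 0 \<Longrightarrow> arr t 2 = arr s 2 \<Longrightarrow> loads n adj t"
  by (simp add: loads_def)

definition row_offsets :: lprog where
  "row_offsets = LFor 2 (LStore 2 (Plus (Reg 2) (Const 1)) (Plus (Arr 2 (Reg 2)) (Reg 0)))"

lemma row_offsets_syntax [simp]:
  "well_formed row_offsets" "writes row_offsets = {2}" "stores row_offsets = {2}"
  by (auto simp: row_offsets_def)

lemma row_offsets_loads: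
  assumes "\<And>v. {v} \<notin> edges G"
  shows "loads n (graph_adj G) (sem row_offsets (input_state n G))"
proof -
  let ?s = "input_state n G"
  have "\<forall>u\<le>n. arr (sem row_offsets ?s) 2 u = u * n"
    unfolding row_offsets_def
  proof (rule sem_LFor[where I = "\<lambda>k t. \<forall>u\<le>k. arr t 2 u = u * n"])
    fix k and t :: state
    assume "k < n" "reg t 2 = k" "\<forall>u\<le>k. arr t 2 u = u * n"
      and r: "\<And>y. y \<notin> insert 2 (writes (LStore 2 (Plus (Reg 2) (Const 1)) (Plus (Arr 2 (Reg 2)) (Reg 0))))
        \<Longrightarrow> reg t y = reg ?s y"
    moreover have "reg t 0 = n" using r[of 0] by (simp add: input_state_def)
    ultimately show "\<forall>u\<le>Suc k. arr (set_reg 2 (Suc k) (sem (LStore 2 (Plus (Reg 2) (Const 1))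
        (Plus (Arr 2 (Reg 2)) (Reg 0))) t)) 2 u = u * n"
      by (auto simp: le_Suc_eq)
  qed (auto simp: input_state_def)
  moreover have "u * n + v < n * n" if "u < n" "v < n" for u v
  proof -
    have "u * n + v < Suc u * n" using that by simp
    also have "\<dots> \<le> n * n" using that by (intro mult_le_mono1) simp
    finally show ?thesis .
  qed
  ultimately show ?thesis
    by (simp add: loads_def graph_adj_def sem_frame) (simp add: input_state_def)
qed

text \<open>The two component names and the comparison of the sides are saved in registers 5, 6 and
  7, because the loop overwrites the entries they come from. If both ends of the edge are already in
  one component, nothing changes, since their sides then differ.\<close>

definition merge_components :: lprog where
  "merge_components =
     LAssign 5 (Arr 4 (Reg 3)) ;; LAssign 6 (Arr 4 (Reg 2)) ;;
     LIf (Equal (Arr 3 (Reg 2)) (Arr 3 (Reg 3))) (LAssign 7 (Const 1)) (LAssign 7 (Const 0)) ;;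
     LFor 4 (LIf (Equal (Arr 4 (Reg 4)) (Reg 5))
       (LStore 4 (Reg 4) (Reg 6) ;;
        LIf (Equal (Reg 7) (Const 1)) (LStore 3 (Reg 4) (Minus (Const 3) (Arr 3 (Reg 4)))) LSkip)
       LSkip)"

definition find_sides :: lprog where
  "find_sides =
     LFor 2 (LStore 4 (Reg 2) (Reg 2) ;; LStore 3 (Reg 2) (Const 1)) ;;
     LFor 2 (LFor 3 (LIf (Equal (adj_exp 2 3) (Const 1)) merge_components LSkip))"

lemma merge_components_syntax [simp]:
  "well_formed merge_components" "writes merge_components = {4, 5, 6, 7}"
  "stores merge_components = {3, 4}"
  by (auto simp: merge_components_def)

lemma sem_merge_components:
  assumes n: "reg s 0 = n" and u: "reg s 2 = u" "u < n" and v: "reg s 3 = v" "v < n"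
  shows "w < n \<Longrightarrow> arr (sem merge_components s) 4 w =
      (if arr s 4 w = arr s 4 v then arr s 4 u else arr s 4 w)"
    and "w < n \<Longrightarrow> arr (sem merge_components s) 3 w =
      (if arr s 4 w = arr s 4 v \<and> arr s 3 u = arr s 3 v then 3 - arr s 3 w else arr s 3 w)"
proof -
  let ?body = "LIf (Equal (Arr 4 (Reg 4)) (Reg 5))
       (LStore 4 (Reg 4) (Reg 6) ;;
        LIf (Equal (Reg 7) (Const 1)) (LStore 3 (Reg 4) (Minus (Const 3) (Arr 3 (Reg 4)))) LSkip)
       LSkip"
  let ?s = "set_reg 7 (if arr s 3 u = arr s 3 v then 1 else 0)
    (set_reg 6 (arr s 4 u) (set_reg 5 (arr s 4 v) s))"
  have eq: "sem merge_components s = sem (LFor 4 ?body) ?s"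
    unfolding merge_components_def by (simp add: u v)
  have "\<forall>w. arr (sem merge_components s) 4 w =
        (if w < n \<and> arr s 4 w = arr s 4 v then arr s 4 u else arr s 4 w) \<and>
      arr (sem merge_components s) 3 w =
        (if w < n \<and> arr s 4 w = arr s 4 v \<and> arr s 3 u = arr s 3 v then 3 - arr s 3 w else arr s 3 w)"
    unfolding eq
  proof (rule sem_LFor[where I = "\<lambda>k t. \<forall>w. arr t 4 w =
        (if w < k \<and> arr s 4 w = arr s 4 v then arr s 4 u else arr s 4 w) \<and>
      arr t 3 w =
        (if w < k \<and> arr s 4 w = arr s 4 v \<and> arr s 3 u = arr s 3 v then 3 - arr s 3 w else arr s 3 w)"])
    fix k and t :: state
    assume k: "k < n" "reg t 4 = k" and I: "\<forall>w. arr t 4 w =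
        (if w < k \<and> arr s 4 w = arr s 4 v then arr s 4 u else arr s 4 w) \<and>
      arr t 3 w =
        (if w < k \<and> arr s 4 w = arr s 4 v \<and> arr s 3 u = arr s 3 v then 3 - arr s 3 w else arr s 3 w)"
      and r: "\<And>y. y \<notin> insert 4 (writes ?body) \<Longrightarrow> reg t y = reg ?s y"
    have "reg t 5 = arr s 4 v" "reg t 6 = arr s 4 u" "reg t 7 = (if arr s 3 u = arr s 3 v then 1 else 0)"
      using r[of 5] r[of 6] r[of 7] by simp_all
    then show "\<forall>w. arr (set_reg 4 (Suc k) (sem ?body t)) 4 w =
        (if w < Suc k \<and> arr s 4 w = arr s 4 v then arr s 4 u else arr s 4 w) \<and>
      arr (set_reg 4 (Suc k) (sem ?body t)) 3 w =
        (if w < Suc k \<and> arr s 4 w = arr s 4 v \<and> arr s 3 u = arr s 3 v then 3 - arr s 3 w else arr s 3 w)"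
      using k I by (auto simp: less_Suc_eq)
  qed (simp_all add: n)
  then show "w < n \<Longrightarrow> arr (sem merge_components s) 4 w =
      (if arr s 4 w = arr s 4 v then arr s 4 u else arr s 4 w)"
    "w < n \<Longrightarrow> arr (sem merge_components s) 3 w =
      (if arr s 4 w = arr s 4 v \<and> arr s 3 u = arr s 3 v then 3 - arr s 3 w else arr s 3 w)"
    by simp_all
qed

text \<open>Here \<open>c\<close> is any proper 2-colouring. The computed sides agree with it on
  each current component up to a swap of the two sides.\<close>

definition consistent :: "nat \<Rightarrow> (nat \<Rightarrow> bool) \<Rightarrow> state \<Rightarrow> bool" where
  "consistent n c s \<longleftrightarrow> (\<forall>u<n. \<forall>v<n. (arr s 3 u = 1 \<or> arr s 3 u = 2) \<and>
     (arr s 4 u = arr s 4 v \<longrightarrow> (arr s 3 u = arr s 3 v \<longleftrightarrow> c u = c v)))"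

lemma consistent_merge_components:
  assumes con: "consistent n c s" and n: "reg s 0 = n" and u: "reg s 2 = u" "u < n"
    and v: "reg s 3 = v" "v < n" and "c u \<noteq> c v"
  shows "consistent n c (sem merge_components s)"
proof -
  note m = sem_merge_components[OF n u v]
  have range: "arr s 3 w = 1 \<or> arr s 3 w = 2" if "w < n" for w
    using con that unfolding consistent_def by blast
  have same: "arr s 3 w = arr s 3 x \<longleftrightarrow> c w = c x" if "arr s 4 w = arr s 4 x" "w < n" "x < n" for w x
    using con that unfolding consistent_def by blast
  let ?t = "sem merge_components s"
  have range': "arr ?t 3 w = 1 \<or> arr ?t 3 w = 2" if "w < n" for w
    unfolding m(2)[OF that] using range[OF that] by auto
  \<comment> \<open>As there are only two sides and two colours, it suffices to compare each vertex
    of the merged component with \<open>u\<close>.\<close>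
  have merged: "arr ?t 3 w = arr s 3 u \<longleftrightarrow> c w = c u" if w: "w < n" "arr ?t 4 w = arr s 4 u" for w
  proof (cases "arr s 4 w = arr s 4 v")
    case True
    have "arr s 3 w = arr s 3 v \<longleftrightarrow> c w = c v" using same[OF True w(1) v(2)] .
    then show ?thesis
      unfolding m(2)[OF w(1)] using True range[OF w(1)] range[OF u(2)] range[OF v(2)] assms(7) by auto
  next
    case False
    then show ?thesis using w same[of w u] u(2) unfolding m(1)[OF w(1)] m(2)[OF w(1)] by simp
  qed
  have "arr ?t 3 w = arr ?t 3 x \<longleftrightarrow> c w = c x"
    if w: "w < n" "x < n" and eq: "arr ?t 4 w = arr ?t 4 x" for w x
  proof (cases "arr ?t 4 w = arr s 4 u")
    case True
    then show ?thesis
      using merged[OF w(1)] merged[OF w(2)] eq range'[OF w(1)] range'[OF w(2)] range[OF u(2)] by auto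
  next
    case False
    then have "arr s 4 w \<noteq> arr s 4 v" "arr s 4 x \<noteq> arr s 4 v"
      using eq unfolding m(1)[OF w(1)] m(1)[OF w(2)] by (auto split: if_splits)
    then show ?thesis
      using eq same[of w x] w unfolding m(1)[OF w(1)] m(1)[OF w(2)] m(2)[OF w(1)] m(2)[OF w(2)] by simp
  qed
  with range' show ?thesis unfolding consistent_def by blast
qed

lemma find_sides_syntax [simp]:
  "well_formed find_sides" "writes find_sides = {2, 3, 4, 5, 6, 7}" "stores find_sides = {3, 4}"
  by (auto simp: find_sides_def)

text \<open>The colouring \<open>c\<close> exists only in the proof. Once all pairs have been
  treated, the ends of each edge are in one component, and consistency with \<open>c\<close> gives
  them different sides.\<close>

lemma find_sides_proper:
  assumes loads: "loads n adj s" and c: "\<And>u v. adj u v \<Longrightarrow> c u \<noteq> (c v :: bool)"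
  shows "\<forall>u<n. arr (sem find_sides s) 3 u = 1 \<or> arr (sem find_sides s) 3 u = 2"
    and "\<forall>u<n. \<forall>v<n. adj u v \<longrightarrow> arr (sem find_sides s) 3 u \<noteq> arr (sem find_sides s) 3 v"
proof -
  let ?p = "LStore 4 (Reg 2) (Reg 2) ;; LStore 3 (Reg 2) (Const 1)"
  let ?q = "LIf (Equal (adj_exp 2 3) (Const 1)) merge_components LSkip"
  let ?s = "sem (LFor 2 ?p) s"
  have n: "reg s 0 = n" using loads by (rule loadsD)
  have "\<forall>u<n. arr ?s 3 u = 1 \<and> arr ?s 4 u = u"
    by (rule sem_LFor[where I = "\<lambda>k t. \<forall>u<k. arr t 3 u = 1 \<and> arr t 4 u = u"])
      (auto simp: n less_Suc_eq)
  then have init: "consistent n c ?s" by (auto simp: consistent_def)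
  have loads': "loads n adj ?s" by (rule loads_cong[OF loads]) (simp_all add: sem_frame)
  have "consistent n c (sem find_sides s) \<and>
      (\<forall>u<n. \<forall>v<n. adj u v \<longrightarrow> arr (sem find_sides s) 4 u = arr (sem find_sides s) 4 v)"
    unfolding find_sides_def sem.simps(4)
  proof (rule sem_LFor[where I = "\<lambda>k t. consistent n c t \<and>
      (\<forall>u<k. \<forall>v<n. adj u v \<longrightarrow> arr t 4 u = arr t 4 v)"])
    fix k and t :: state
    assume k: "k < n" "reg t 2 = k"
      and r: "\<And>y. y \<notin> insert 2 (writes (LFor 3 ?q)) \<Longrightarrow> reg t y = reg ?s y"
      and a: "\<And>m. m \<notin> stores (LFor 3 ?q) \<Longrightarrow> arr t m = arr ?s m"
      and I: "consistent n c t \<and> (\<forall>u<k. \<forall>v<n. adj u v \<longrightarrow> arr t 4 u = arr t 4 v)"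
    have loads_t: "loads n adj t" by (rule loads_cong[OF loads']) (simp_all add: r a)
    have "consistent n c (sem (LFor 3 ?q) t) \<and>
        (\<forall>u<n. \<forall>v<n. adj u v \<and> (u < k \<or> u = k \<and> v < n) \<longrightarrow>
          arr (sem (LFor 3 ?q) t) 4 u = arr (sem (LFor 3 ?q) t) 4 v)"
    proof (rule sem_LFor[where I = "\<lambda>j t. consistent n c t \<and>
        (\<forall>u<n. \<forall>v<n. adj u v \<and> (u < k \<or> u = k \<and> v < j) \<longrightarrow> arr t 4 u = arr t 4 v)"])
      show "reg t 0 = n" using loads_t by (rule loadsD)
      fix j and t' :: state
      assume j: "j < n" "reg t' 3 = j"
        and r': "\<And>y. y \<notin> insert 3 (writes ?q) \<Longrightarrow> reg t' y = reg t y"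
        and a': "\<And>m. m \<notin> stores ?q \<Longrightarrow> arr t' m = arr t m"
        and I': "consistent n c t' \<and>
          (\<forall>u<n. \<forall>v<n. adj u v \<and> (u < k \<or> u = k \<and> v < j) \<longrightarrow> arr t' 4 u = arr t' 4 v)"
      have "loads n adj t'" by (rule loads_cong[OF loads_t]) (simp_all add: r' a')
      note l = loadsD[OF this]
      have k': "reg t' 2 = k" using r'[of 2] k by simp
      have b: "bval (Equal (adj_exp 2 3) (Const 1)) t' \<longleftrightarrow> adj k j"
        using l(2)[OF k(1) j(1)] k' j by simp
      have con: "consistent n c (sem ?q t')"
        using consistent_merge_components[OF _ l(1) k' k(1) j(2,1), of c] I' c[of k j] b
        by simp
      have comp: "arr (sem ?q t') 4 u = arr (sem ?q t') 4 v"
        if "u < n" "v < n" "adj u v \<and> (u < k \<or> u = k \<and> v < Suc j)" for u v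
      proof (cases "adj k j")
        case True
        have "arr t' 4 u = arr t' 4 v \<or> u = k \<and> v = j"
          using that I' by (auto simp: less_Suc_eq)
        moreover have "sem ?q t' = sem merge_components t'" using b True by simp
        ultimately show ?thesis
          using sem_merge_components(1)[OF l(1) k' k(1) j(2,1) that(1)]
            sem_merge_components(1)[OF l(1) k' k(1) j(2,1) that(2)] by auto
      next
        case False
        then have "u < k \<or> u = k \<and> v < j" using that(3) by (auto simp: less_Suc_eq)
        then show ?thesis using I' that b False by simp
      qed
      show "consistent n c (set_reg 3 (Suc j) (sem ?q t')) \<and>
        (\<forall>u<n. \<forall>v<n. adj u v \<and> (u < k \<or> u = k \<and> v < Suc j) \<longrightarrow>
          arr (set_reg 3 (Suc j) (sem ?q t')) 4 u = arr (set_reg 3 (Suc j) (sem ?q t')) 4 v)"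
        using con comp unfolding consistent_def by simp
    qed (use I k in \<open>auto simp: consistent_def\<close>)
    then show "consistent n c (set_reg 2 (Suc k) (sem (LFor 3 ?q) t)) \<and>
      (\<forall>u<Suc k. \<forall>v<n. adj u v \<longrightarrow> arr (set_reg 2 (Suc k) (sem (LFor 3 ?q) t)) 4 u =
         arr (set_reg 2 (Suc k) (sem (LFor 3 ?q) t)) 4 v)"
      using k unfolding consistent_def by (auto simp: less_Suc_eq)
  next
    show "reg ?s 0 = n" using loads' by (rule loadsD)
  qed (use init in \<open>auto simp: consistent_def\<close>)
  then show "\<forall>u<n. arr (sem find_sides s) 3 u = 1 \<or> arr (sem find_sides s) 3 u = 2"
    "\<forall>u<n. \<forall>v<n. adj u v \<longrightarrow> arr (sem find_sides s) 3 u \<noteq> arr (sem find_sides s) 3 v"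
    unfolding consistent_def using c by blast+
qed

section \<open>Splitting a class\<close>

text \<open>The guard is evaluated in an arbitrary state that differs only in the counters and in
  array \<open>m\<close>. Hence earlier marks cannot influence later ones, and the outcome is a
  plain existential statement.\<close>

lemma sem_mark_loop:
  assumes wf: "x \<noteq> 0" "y \<noteq> 0" "x \<noteq> y" and n: "reg s 0 = n"
    and b: "\<And>t u v. u < n \<Longrightarrow> v < n \<Longrightarrow> reg t x = u \<Longrightarrow> reg t y = v \<Longrightarrow>
      (\<And>r. r \<noteq> x \<Longrightarrow> r \<noteq> y \<Longrightarrow> reg t r = reg s r) \<Longrightarrow>
      (\<And>a. a \<noteq> m \<Longrightarrow> arr t a = arr s a) \<Longrightarrow> bval b t \<longleftrightarrow> P u v"
    and v: "v < n"
  shows "arr (sem (LFor x (LFor y (LIf b (LStore m (Reg y) (Const 1)) LSkip))) s) m v =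
    (if \<exists>u<n. P u v then 1 else arr s m v)"
proof -
  let ?q = "LIf b (LStore m (Reg y) (Const 1)) LSkip"
  have "\<forall>v<n. arr (sem (LFor x (LFor y ?q)) s) m v = (if \<exists>u<n. P u v then 1 else arr s m v)"
  proof (rule sem_LFor[where I = "\<lambda>k t. \<forall>v<n. arr t m v = (if \<exists>u<k. P u v then 1 else arr s m v)"])
    fix k and t :: state
    assume k: "k < n" "reg t x = k"
      and r: "\<And>r. r \<notin> insert x (writes (LFor y ?q)) \<Longrightarrow> reg t r = reg s r"
      and a: "\<And>a. a \<notin> stores (LFor y ?q) \<Longrightarrow> arr t a = arr s a"
      and I: "\<forall>v<n. arr t m v = (if \<exists>u<k. P u v then 1 else arr s m v)"
    have "\<forall>v<n. arr (sem (LFor y ?q) t) m v = (if v < n \<and> P k v then 1 else arr t m v)"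
    proof (rule sem_LFor[where I = "\<lambda>j t'. \<forall>v<n. arr t' m v = (if v < j \<and> P k v then 1 else arr t m v)"])
      show "reg t 0 = n" using r[of 0] wf n by simp
      fix j and t' :: state
      assume j: "j < n" "reg t' y = j"
        and r': "\<And>r. r \<notin> insert y (writes ?q) \<Longrightarrow> reg t' r = reg t r"
        and a': "\<And>a. a \<notin> stores ?q \<Longrightarrow> arr t' a = arr t a"
        and I': "\<forall>v<n. arr t' m v = (if v < j \<and> P k v then 1 else arr t m v)"
      have "bval b t' \<longleftrightarrow> P k j"
        using k j wf r r' a a' by (intro b) auto
      then show "\<forall>v<n. arr (set_reg y (Suc j) (sem ?q t')) m v = (if v < Suc j \<and> P k v then 1 else arr t m v)"
        using I' j by (auto simp: less_Suc_eq)
    qed (use wf in auto)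
    then show "\<forall>v<n. arr (set_reg x (Suc k) (sem (LFor y ?q) t)) m v =
        (if \<exists>u<Suc k. P u v then 1 else arr s m v)"
      using I by (auto simp: less_Suc_eq)
  qed (use wf n in auto)
  then show ?thesis using v by blast
qed

lemma sem_flag_loop:
  assumes wf: "x \<noteq> 0" "y \<noteq> 0" "x \<noteq> y" "f \<noteq> 0" "f \<noteq> x" "f \<noteq> y" and n: "reg s 0 = n"
    and b: "\<And>t u v. u < n \<Longrightarrow> v < n \<Longrightarrow> reg t x = u \<Longrightarrow> reg t y = v \<Longrightarrow>
      (\<And>r. r \<noteq> x \<Longrightarrow> r \<noteq> y \<Longrightarrow> r \<noteq> f \<Longrightarrow> reg t r = reg s r) \<Longrightarrow>
      arr t = arr s \<Longrightarrow> bval b t \<longleftrightarrow> P u v"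
  shows "reg (sem (LFor x (LFor y (LIf b (LAssign f (Const 1)) LSkip))) s) f =
    (if \<exists>u<n. \<exists>v<n. P u v then 1 else reg s f)"
proof -
  let ?q = "LIf b (LAssign f (Const 1)) LSkip"
  show ?thesis
  proof (rule sem_LFor[where I = "\<lambda>k t. reg t f = (if \<exists>u<k. \<exists>v<n. P u v then 1 else reg s f)"])
    fix k and t :: state
    assume k: "k < n" "reg t x = k"
      and r: "\<And>r. r \<notin> insert x (writes (LFor y ?q)) \<Longrightarrow> reg t r = reg s r"
      and a: "\<And>a. a \<notin> stores (LFor y ?q) \<Longrightarrow> arr t a = arr s a"
      and I: "reg t f = (if \<exists>u<k. \<exists>v<n. P u v then 1 else reg s f)"
    have "reg (sem (LFor y ?q) t) f = (if \<exists>v<n. P k v then 1 else reg t f)"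
    proof (rule sem_LFor[where I = "\<lambda>j t'. reg t' f = (if \<exists>v<j. P k v then 1 else reg t f)"])
      show "reg t 0 = n" using r[of 0] wf n by simp
      fix j and t' :: state
      assume j: "j < n" "reg t' y = j"
        and r': "\<And>r. r \<notin> insert y (writes ?q) \<Longrightarrow> reg t' r = reg t r"
        and a': "\<And>a. a \<notin> stores ?q \<Longrightarrow> arr t' a = arr t a"
        and I': "reg t' f = (if \<exists>v<j. P k v then 1 else reg t f)"
      have "bval b t' \<longleftrightarrow> P k j"
        using k j wf r r' a a' by (intro b) auto
      then show "reg (set_reg y (Suc j) (sem ?q t')) f = (if \<exists>v<Suc j. P k v then 1 else reg t f)"
        using I' wf by (auto simp: less_Suc_eq)
    qed (use wf in auto)
    then show "reg (set_reg x (Suc k) (sem (LFor y ?q) t)) f =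
        (if \<exists>u<Suc k. \<exists>v<n. P u v then 1 else reg s f)"
      using I wf by (auto simp: less_Suc_eq)
  qed (use wf n in auto)
qed

text \<open>Register 2 holds the candidate \<open>z\<close>, register 3 runs through
  \<open>e\<close> and register 4 through \<open>w\<close>. The nested negations express the
  disjunction in \<open>near\<close>.\<close>

definition mark_near :: lprog where
  "mark_near =
     LFor 3 (LStore 5 (Reg 3) (Const 0)) ;;
     LFor 3 (LFor 4 (LIf
       (And (Equal (Arr 6 (Reg 3)) (Reg 10)) (And (Equal (adj_exp 2 3) (Const 1))
         (And (Equal (Arr 6 (Reg 4)) (Reg 10))
           (Not (And (Not (Equal (Reg 3) (Reg 4)))
             (Not (And (Equal (adj_exp 3 4) (Const 1)) (Not (Equal (Reg 4) (Reg 2))))))))))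
       (LStore 5 (Reg 4) (Const 1)) LSkip))"

definition check_splitter :: lprog where
  "check_splitter =
     LAssign 5 (Const 0) ;;
     LFor 3 (LFor 4 (LIf
       (And (Equal (Arr 6 (Reg 3)) (Reg 10)) (And (Not (Equal (Arr 3 (Reg 3)) (Arr 3 (Reg 2))))
         (And (Not (Equal (adj_exp 2 3) (Const 1))) (And (Equal (Arr 5 (Reg 4)) (Const 1))
           (And (Equal (Arr 3 (Reg 4)) (Arr 3 (Reg 2))) (Not (Equal (adj_exp 3 4) (Const 1))))))))
       (LAssign 5 (Const 1)) LSkip))"

text \<open>The loop cannot be left early, so all vertices are tried, even those outside the class,
  and the last splitter found stays in register 6. Two quadratic tests per candidate give cubic
  time.\<close>

definition find_splitter :: lprog where
  "find_splitter =
     LFor 2 (mark_near ;; check_splitter ;;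
       LIf (And (Equal (Arr 6 (Reg 2)) (Reg 10)) (Equal (Reg 5) (Const 0))) (LAssign 6 (Reg 2)) LSkip)"

text \<open>The marks are recomputed because array 5 belongs to the last candidate tried. The near
  part receives the fresh name from register 11, while the far part keeps the name of the class.
  Registers 7 and 8 record whether the near and the far part are nonempty.\<close>

definition split_class :: lprog where
  "split_class =
     LAssign 2 (Reg 6) ;; mark_near ;; LAssign 7 (Const 0) ;; LAssign 8 (Const 0) ;;
     LFor 3 (LIf (Equal (Arr 5 (Reg 3)) (Const 1))
       (LStore 6 (Reg 3) (Reg 11) ;; LAssign 7 (Const 1))
       (LIf (And (Equal (Arr 6 (Reg 3)) (Reg 10)) (Not (Equal (Reg 3) (Reg 2))))
         (LAssign 8 (Const 1)) LSkip)) ;;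
     LStore 6 (Reg 2) (Const 0) ;; LAssign 9 (Arr 3 (Reg 2))"

text \<open>Postfix code for the operations of \<open>attach_far\<close>, with the class name
  standing where the code of the far part will go.\<close>

definition far_items :: "aexp list" where
  "far_items = [Reg 10, Const 2, Const 1, Const 3, Const 2, Const 2, Const 4, Const 1,
     Const 3, Reg 9, Minus (Const 5) (Reg 9), Const 2, Const 3, Const 1, Const 2, Const 4, Const 2]"

definition near_items :: "aexp list" where
  "near_items = [Reg 11, Const 1, Const 3, Const 5, Minus (Const 3) (Reg 9)]"

text \<open>\<open>Create 5 z\<close> comes first in the postfix form and is output at once. So
  vertex names never enter the stack, where they could be mistaken for class names. Everything else
  is pushed in reverse order, to be popped from left to right.\<close>

definition schedule :: lprog where
  "schedule =
     append_all 1 1 [Const 0, Const 5, Reg 2] ;;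
     append_all 7 12 [Reg 9, Const 5, Const 2] ;;
     LIf (Equal (Reg 8) (Const 1)) (append_all 7 12 (rev far_items)) LSkip ;;
     LIf (Equal (Reg 7) (Const 1)) (append_all 7 12 (rev near_items)) LSkip ;;
     LAssign 11 (Plus (Reg 11) (Const 1))"

lemma programs_syntax [simp]:
  "well_formed mark_near" "writes mark_near = {3, 4}" "stores mark_near = {5}"
  "well_formed check_splitter" "writes check_splitter = {3, 4, 5}" "stores check_splitter = {}"
  "well_formed find_splitter" "writes find_splitter = {2, 3, 4, 5, 6}" "stores find_splitter = {5}"
  "well_formed split_class" "writes split_class = {2, 3, 4, 7, 8, 9}" "stores split_class = {5, 6}"
  "well_formed schedule" "writes schedule = {1, 11, 12}" "stores schedule = {1, 7}"
  by (auto simp: mark_near_def check_splitter_def find_splitter_def split_class_def schedule_def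
      far_items_def near_items_def)

section \<open>Correctness of the splitting programs\<close>

definition class_of :: "nat \<Rightarrow> state \<Rightarrow> nat \<Rightarrow> nat set" where
  "class_of n s i = {v. v < n \<and> arr s 6 v = i}"

context bipartite_relation
begin

lemma splitterI_iff:
  "splitter C z \<longleftrightarrow> z \<in> C \<and> \<not> (\<exists>f\<in>C. side f \<noteq> side z \<and> \<not> adj z f \<and>
     (\<exists>w\<in>near C z. side w = side z \<and> \<not> adj f w))"
  unfolding splitter_def by blast

end

locale bipartite_nat = bipartite_relation adj side
  for adj :: "nat \<Rightarrow> nat \<Rightarrow> bool" and side :: "nat \<Rightarrow> nat" +
  fixes n :: nat
begin

definition ready :: "state \<Rightarrow> bool" where
  "ready s \<longleftrightarrow> loads n adj s \<and> (\<forall>v<n. arr s 3 v = side v)"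

lemma readyD:
  assumes "ready s"
  shows "reg s 0 = n" "u < n \<Longrightarrow> v < n \<Longrightarrow> arr s 0 (arr s 2 u + v) = (if adj u v then 1 else 0)"
    "v < n \<Longrightarrow> arr s 3 v = side v"
  using assms by (auto simp: ready_def loads_def)

lemma ready_cong:
  "ready s \<Longrightarrow> reg t 0 = reg s 0 \<Longrightarrow> arr t 0 = arr s 0 \<Longrightarrow> arr t 2 = arr s 2 \<Longrightarrow>
    arr t 3 = arr s 3 \<Longrightarrow> ready t"
  by (simp add: ready_def loads_def)

lemma sem_mark_near:
  assumes s: "ready s" and z: "reg s 2 = z" "z < n" and w: "w < n"
  shows "arr (sem mark_near s) 5 w = (if w \<in> near (class_of n s (reg s 10)) z then 1 else 0)"
proof -
  let ?C = "class_of n s (reg s 10)"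
  let ?s = "sem (LFor 3 (LStore 5 (Reg 3) (Const 0))) s"
  let ?P = "\<lambda>e w. arr s 6 e = reg s 10 \<and> adj z e \<and> arr s 6 w = reg s 10 \<and> (e = w \<or> adj e w \<and> w \<noteq> z)"
  have "\<forall>w<n. arr ?s 5 w = 0"
    by (rule sem_LFor[where I = "\<lambda>k t. \<forall>w<k. arr t 5 w = 0"])
      (auto simp: readyD[OF s] less_Suc_eq)
  moreover have "arr (sem mark_near s) 5 w = (if \<exists>e<n. ?P e w then 1 else arr ?s 5 w)"
    unfolding mark_near_def sem.simps(4)
  proof (rule sem_mark_loop)
    fix t :: state and u v
    assume uv: "u < n" "v < n" "reg t 3 = u" "reg t 4 = v"
      and r: "\<And>r. r \<noteq> 3 \<Longrightarrow> r \<noteq> 4 \<Longrightarrow> reg t r = reg ?s r"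
      and a: "\<And>a. a \<noteq> 5 \<Longrightarrow> arr t a = arr ?s a"
    have "ready t" by (rule ready_cong[OF s]) (simp_all add: r a sem_frame)
    note t = readyD[OF this]
    have "reg t 2 = z" "reg t 10 = reg s 10" "arr t 6 = arr s 6"
      by (simp_all add: r a sem_frame z)
    then show "bval (And (Equal (Arr 6 (Reg 3)) (Reg 10)) (And (Equal (adj_exp 2 3) (Const 1))
         (And (Equal (Arr 6 (Reg 4)) (Reg 10))
           (Not (And (Not (Equal (Reg 3) (Reg 4)))
             (Not (And (Equal (adj_exp 3 4) (Const 1)) (Not (Equal (Reg 4) (Reg 2)))))))))) t \<longleftrightarrow> ?P u v"
      using uv z t(2)[of u v] t(2)[of z u] by simp
  qed (use w readyD[OF s] in \<open>auto simp: sem_frame\<close>)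
  moreover have "(\<exists>e<n. ?P e w) \<longleftrightarrow> w \<in> near ?C z"
    using w by (auto simp: near_def class_of_def)
  ultimately show ?thesis using w by simp
qed

lemma sem_check_splitter:
  assumes s: "ready s" and z: "reg s 2 = z" "z < n"
    and mark: "\<And>w. w < n \<Longrightarrow> arr s 5 w = (if w \<in> near (class_of n s (reg s 10)) z then 1 else 0)"
  shows "reg (sem check_splitter s) 5 = 0 \<longleftrightarrow>
    \<not> (\<exists>f \<in> class_of n s (reg s 10). side f \<noteq> side z \<and> \<not> adj z f \<and>
      (\<exists>w \<in> near (class_of n s (reg s 10)) z. side w = side z \<and> \<not> adj f w))"
proof -
  let ?C = "class_of n s (reg s 10)"
  let ?P = "\<lambda>f w. f \<in> ?C \<and> side f \<noteq> side z \<and> \<not> adj z f \<and> w \<in> near ?C z \<and> side w = side z \<and> \<not> adj f w"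
  have "reg (sem check_splitter s) 5 = (if \<exists>f<n. \<exists>w<n. ?P f w then 1 else reg (set_reg 5 0 s) 5)"
    unfolding check_splitter_def sem.simps(2,4) aval.simps
  proof (rule sem_flag_loop)
    fix t :: state and u v
    assume uv: "u < n" "v < n" "reg t 3 = u" "reg t 4 = v"
      and r: "\<And>r. r \<noteq> 3 \<Longrightarrow> r \<noteq> 4 \<Longrightarrow> r \<noteq> 5 \<Longrightarrow> reg t r = reg (set_reg 5 0 s) r"
      and a: "arr t = arr (set_reg 5 0 s)"
    have "ready t" by (rule ready_cong[OF s]) (simp_all add: r a sem_frame)
    note t = readyD[OF this]
    have "reg t 2 = z" "reg t 10 = reg s 10" "arr t 6 = arr s 6" "arr t 5 = arr s 5"
      by (simp_all add: r a z)
    then show "bval (And (Equal (Arr 6 (Reg 3)) (Reg 10)) (And (Not (Equal (Arr 3 (Reg 3)) (Arr 3 (Reg 2))))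
         (And (Not (Equal (adj_exp 2 3) (Const 1))) (And (Equal (Arr 5 (Reg 4)) (Const 1))
           (And (Equal (Arr 3 (Reg 4)) (Arr 3 (Reg 2))) (Not (Equal (adj_exp 3 4) (Const 1)))))))) t \<longleftrightarrow> ?P u v"
      using uv z t(2)[of u v] t(2)[of z u] t(3)[of u] t(3)[of v] t(3)[of z] mark[of v]
      by (simp add: class_of_def)
  qed (use readyD[OF s] in auto)
  moreover have "(\<exists>f<n. \<exists>w<n. ?P f w) \<longleftrightarrow> (\<exists>f \<in> ?C. side f \<noteq> side z \<and> \<not> adj z f \<and>
      (\<exists>w \<in> near ?C z. side w = side z \<and> \<not> adj f w))"
  proof -
    have "f < n" if "f \<in> ?C" for f using that by (simp add: class_of_def)
    moreover have "w < n" if "w \<in> near ?C z" for w using that by (simp add: class_of_def near_def)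
    ultimately show ?thesis by blast
  qed
  ultimately show ?thesis by simp
qed

lemma sem_find_splitter:
  assumes s: "ready s" and C: "C = class_of n s (reg s 10)" and ex: "\<exists>z. splitter C z"
  shows "splitter C (reg (sem find_splitter s) 6)"
proof -
  let ?q = "mark_near ;; check_splitter ;;
       LIf (And (Equal (Arr 6 (Reg 2)) (Reg 10)) (Equal (Reg 5) (Const 0))) (LAssign 6 (Reg 2)) LSkip"
  have "(\<exists>z<n. splitter C z) \<longrightarrow> splitter C (reg (sem find_splitter s) 6)"
    unfolding find_splitter_def
  proof (rule sem_LFor[where I = "\<lambda>k t. (\<exists>z<k. splitter C z) \<longrightarrow> splitter C (reg t 6)"])
    fix k and t :: state
    assume k: "k < n" "reg t 2 = k" and I: "(\<exists>z<k. splitter C z) \<longrightarrow> splitter C (reg t 6)"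
      and r: "\<And>r. r \<notin> insert 2 (writes ?q) \<Longrightarrow> reg t r = reg s r"
      and a: "\<And>a. a \<notin> stores ?q \<Longrightarrow> arr t a = arr s a"
    have ready: "ready t" by (rule ready_cong[OF s]) (simp_all add: r a)
    let ?t = "sem mark_near t"
    have Ct: "class_of n t (reg t 10) = C" unfolding C by (simp add: class_of_def r a)
    have Ct': "class_of n ?t (reg ?t 10) = C" using Ct by (simp add: class_of_def sem_frame)
    have "ready ?t" by (rule ready_cong[OF ready]) (simp_all add: sem_frame)
    then have "reg (sem check_splitter ?t) 5 = 0 \<longleftrightarrow>
      \<not> (\<exists>f \<in> C. side f \<noteq> side k \<and> \<not> adj k f \<and> (\<exists>w \<in> near C k. side w = side k \<and> \<not> adj f w))"
      using sem_check_splitter[of ?t k, unfolded Ct'] sem_mark_near[OF ready k(2,1), unfolded Ct] k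
      by (simp add: sem_frame)
    moreover have "k \<in> C \<longleftrightarrow> arr t 6 k = reg t 10" using k Ct by (auto simp: class_of_def)
    ultimately have "bval (And (Equal (Arr 6 (Reg 2)) (Reg 10)) (Equal (Reg 5) (Const 0)))
        (sem check_splitter ?t) \<longleftrightarrow> splitter C k"
      unfolding splitterI_iff using k by (simp add: sem_frame)
    then have "reg (sem ?q t) 6 = (if splitter C k then k else reg t 6)"
      using k by (simp add: sem_frame)
    then show "(\<exists>z<Suc k. splitter C z) \<longrightarrow> splitter C (reg (set_reg 2 (Suc k) (sem ?q t)) 6)"
      using I by (auto simp: less_Suc_eq)
  qed (use readyD[OF s] in auto)
  moreover have "\<exists>z<n. splitter C z" using ex by (auto simp: splitter_def C class_of_def)
  ultimately show ?thesis by blast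
qed

lemma sem_split_class:
  assumes s: "ready s" and C: "C = class_of n s (reg s 10)" and z: "reg s 6 = z" "z \<in> C"
    and fresh: "reg s 11 \<noteq> reg s 10"
  shows "v < n \<Longrightarrow> arr (sem split_class s) 6 v =
      (if v = z then 0 else if v \<in> near C z then reg s 11 else arr s 6 v)"
    and "reg (sem split_class s) 7 = (if near C z = {} then 0 else 1)"
    and "reg (sem split_class s) 8 = (if far C z = {} then 0 else 1)"
    and "reg (sem split_class s) 2 = z"
    and "reg (sem split_class s) 9 = side z"
proof -
  have zn: "z < n" using z C by (auto simp: class_of_def)
  let ?q = "LIf (Equal (Arr 5 (Reg 3)) (Const 1))
       (LStore 6 (Reg 3) (Reg 11) ;; LAssign 7 (Const 1))
       (LIf (And (Equal (Arr 6 (Reg 3)) (Reg 10)) (Not (Equal (Reg 3) (Reg 2))))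
         (LAssign 8 (Const 1)) LSkip)"
  let ?m = "sem mark_near (set_reg 2 z s)"
  let ?s = "set_reg 8 0 (set_reg 7 0 ?m)"
  let ?t = "sem (LFor 3 ?q) ?s"
  have eq: "sem split_class s = set_reg 9 (arr ?t 3 z) (set_arr 6 z 0 ?t)"
    unfolding split_class_def using z by (simp add: sem_frame)
  have ready: "ready (set_reg 2 z s)" by (rule ready_cong[OF s]) simp_all
  have mark: "arr ?s 5 w = (if w \<in> near C z then 1 else 0)" if "w < n" for w
    using sem_mark_near[OF ready _ zn that] C by (simp add: class_of_def)
  have other: "reg ?s 2 = z" "reg ?s 10 = reg s 10" "reg ?s 11 = reg s 11" "arr ?s 6 = arr s 6"
    "arr ?s 3 = arr s 3" "reg ?s 0 = n"
    using readyD[OF s] by (simp_all add: sem_frame)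
  have "(\<forall>v. arr ?t 6 v = (if v < n \<and> v \<in> near C z then reg s 11 else arr s 6 v)) \<and>
      reg ?t 7 = (if \<exists>w<n. w \<in> near C z then 1 else 0) \<and>
      reg ?t 8 = (if \<exists>w<n. w \<in> far C z then 1 else 0)"
  proof (rule sem_LFor[where I = "\<lambda>k t.
      (\<forall>v. arr t 6 v = (if v < k \<and> v \<in> near C z then reg s 11 else arr s 6 v)) \<and>
      reg t 7 = (if \<exists>w<k. w \<in> near C z then 1 else 0) \<and>
      reg t 8 = (if \<exists>w<k. w \<in> far C z then 1 else 0)"])
    fix k and t :: state
    assume k: "k < n" "reg t 3 = k"
      and I: "(\<forall>v. arr t 6 v = (if v < k \<and> v \<in> near C z then reg s 11 else arr s 6 v)) \<and>
        reg t 7 = (if \<exists>w<k. w \<in> near C z then 1 else 0) \<and>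
        reg t 8 = (if \<exists>w<k. w \<in> far C z then 1 else 0)"
      and r: "\<And>r. r \<notin> insert 3 (writes ?q) \<Longrightarrow> reg t r = reg ?s r"
      and a: "\<And>a. a \<notin> stores ?q \<Longrightarrow> arr t a = arr ?s a"
    have tr: "reg t 2 = z" "reg t 10 = reg s 10" "reg t 11 = reg s 11"
      using r[of 2] r[of 10] r[of 11] unfolding other by simp_all
    have "arr t 5 k = (if k \<in> near C z then 1 else 0)" using mark[OF k(1)] a[of 5] by simp
    moreover have "arr t 6 k = arr s 6 k" using I by simp
    moreover have "k \<in> C \<longleftrightarrow> arr s 6 k = reg s 10" using k C by (simp add: class_of_def)
    ultimately have q: "sem ?q t = (if k \<in> near C z then set_reg 7 1 (set_arr 6 k (reg s 11) t)
        else if k \<in> far C z then set_reg 8 1 t else t)"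
      using k tr by simp
    have far: "k \<notin> far C z" if "k \<in> near C z" using that by simp
    have Ex: "(\<exists>w<Suc k. P w) \<longleftrightarrow> (\<exists>w<k. P w) \<or> P k" for P by (auto simp: less_Suc_eq)
    have "\<forall>v. arr (sem ?q t) 6 v = (if v < Suc k \<and> v \<in> near C z then reg s 11 else arr s 6 v)"
      unfolding q using I by (auto simp: less_Suc_eq)
    moreover have "reg (sem ?q t) 7 = (if \<exists>w<Suc k. w \<in> near C z then 1 else 0)"
      unfolding q Ex using I by simp
    moreover have "reg (sem ?q t) 8 = (if \<exists>w<Suc k. w \<in> far C z then 1 else 0)"
    proof -
      have "(if k \<notin> N \<and> k \<in> F then 1 else if \<exists>w<k. w \<in> F then 1 else 0 :: nat) =
          (if (\<exists>w<k. w \<in> F) \<or> k \<in> F then 1 else 0)" if "k \<in> N \<Longrightarrow> k \<notin> F" for N F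
        using that by auto
      note this[of "near C z" "far C z", OF far]
      moreover have "reg (sem ?q t) 8 = (if k \<notin> near C z \<and> k \<in> far C z then 1 else reg t 8)"
        unfolding q by simp
      moreover have "reg t 8 = (if \<exists>w<k. w \<in> far C z then 1 else 0)" using I by blast
      ultimately show ?thesis unfolding Ex by (simp only:)
    qed
    ultimately show "(\<forall>v. arr (set_reg 3 (Suc k) (sem ?q t)) 6 v =
          (if v < Suc k \<and> v \<in> near C z then reg s 11 else arr s 6 v)) \<and>
        reg (set_reg 3 (Suc k) (sem ?q t)) 7 = (if \<exists>w<Suc k. w \<in> near C z then 1 else 0) \<and>
        reg (set_reg 3 (Suc k) (sem ?q t)) 8 = (if \<exists>w<Suc k. w \<in> far C z then 1 else 0)"
      by simp
  qed (use other in auto)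
  moreover have "v < n" if "v \<in> near C z \<or> v \<in> far C z" for v
    using that C by (auto simp: near_def class_of_def)
  ultimately show "v < n \<Longrightarrow> arr (sem split_class s) 6 v =
      (if v = z then 0 else if v \<in> near C z then reg s 11 else arr s 6 v)"
    "reg (sem split_class s) 7 = (if near C z = {} then 0 else 1)"
    "reg (sem split_class s) 8 = (if far C z = {} then 0 else 1)"
    unfolding eq by auto
  show "reg (sem split_class s) 2 = z" unfolding eq by (simp add: sem_frame)
  show "reg (sem split_class s) 9 = side z"
    unfolding eq using readyD(3)[OF s zn] by (simp add: sem_frame)
qed

end

section \<open>The main loop\<close>

text \<open>Numbers below 6 on the stack are copied to the output. A number from 6 on is the name of a
  class and stands for the encoding of an expression for that class.\<close>

definition step :: lprog where
  "step =
     LAssign 12 (Minus (Reg 12) (Const 1)) ;; LAssign 10 (Arr 7 (Reg 12)) ;;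
     LIf (Less (Reg 10) (Const 6)) (append_all 1 1 [Reg 10]) (find_splitter ;; split_class ;; schedule)"

lemma step_syntax [simp]:
  "well_formed step" "writes step = {1, 2, 3, 4, 5, 6, 7, 8, 9, 10, 11, 12}" "stores step = {1, 5, 6, 7}"
  by (auto simp: step_def)

lemma contents_frame [simp]:
  "r \<notin> writes p \<Longrightarrow> m \<notin> stores p \<Longrightarrow> contents m r (sem p s) = contents m r s"
  by (simp add: contents_def sem_frame)

lemma contents_set [simp]:
  "x \<noteq> r \<Longrightarrow> contents m r (set_reg x v s) = contents m r s"
  "a \<noteq> m \<Longrightarrow> contents m r (set_arr a i v s) = contents m r s"
  by (simp_all add: contents_def)

lemma sem_schedule:
  shows "contents 1 1 (sem schedule s) = contents 1 1 s @ [0, 5, reg s 2]"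
    and "contents 7 12 (sem schedule s) = contents 7 12 s @ rev
      ((if reg s 7 = 1 then [reg s 11, 1, 3, 5, 3 - reg s 9] else []) @
       (if reg s 8 = 1 then [reg s 10, 2, 1, 3, 2, 2, 4, 1, 3, reg s 9, 5 - reg s 9, 2, 3, 1, 2, 4, 2] else []) @
       [2, 5, reg s 9])"
    and "reg (sem schedule s) 11 = reg s 11 + 1"
proof -
  let ?a = "sem (append_all 1 1 [Const 0, Const 5, Reg 2]) s"
  let ?b = "sem (append_all 7 12 [Reg 9, Const 5, Const 2]) ?a"
  let ?c = "sem (LIf (Equal (Reg 8) (Const 1)) (append_all 7 12 (rev far_items)) LSkip) ?b"
  let ?d = "sem (LIf (Equal (Reg 7) (Const 1)) (append_all 7 12 (rev near_items)) LSkip) ?c"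
  have eq: "sem schedule s = set_reg 11 (reg ?d 11 + 1) ?d" by (simp add: schedule_def)
  have a: "contents 1 1 ?a = contents 1 1 s @ [0, 5, reg s 2]"
    by (subst contents_append_all) auto
  have b: "contents 7 12 ?b = contents 7 12 s @ [reg s 9, 5, 2]"
    by (subst contents_append_all) (auto simp: sem_frame)
  have c: "contents 7 12 ?c = contents 7 12 ?b @ rev (if reg s 8 = 1
      then [reg s 10, 2, 1, 3, 2, 2, 4, 1, 3, reg s 9, 5 - reg s 9, 2, 3, 1, 2, 4, 2] else [])"
    unfolding sem.simps(5) bval.simps if_distrib[of "contents 7 12"]
    by (subst contents_append_all) (auto simp: sem_frame far_items_def)
  have d: "contents 7 12 ?d = contents 7 12 ?c @ rev (if reg s 7 = 1
      then [reg s 11, 1, 3, 5, 3 - reg s 9] else [])"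
    unfolding sem.simps(5)[of _ _ _ ?c] bval.simps if_distrib[of "contents 7 12"]
    by (subst contents_append_all) (auto simp: sem_frame near_items_def far_items_def)
  show "contents 1 1 (sem schedule s) = contents 1 1 s @ [0, 5, reg s 2]"
    unfolding eq a[symmetric] by (simp add: near_items_def far_items_def)
  show "contents 7 12 (sem schedule s) = contents 7 12 s @ rev
      ((if reg s 7 = 1 then [reg s 11, 1, 3, 5, 3 - reg s 9] else []) @
       (if reg s 8 = 1 then [reg s 10, 2, 1, 3, 2, 2, 4, 1, 3, reg s 9, 5 - reg s 9, 2, 3, 1, 2, 4, 2] else []) @
       [2, 5, reg s 9])"
    unfolding eq using b c d by simp
  show "reg (sem schedule s) 11 = reg s 11 + 1"
    unfolding eq by (simp add: sem_frame)
qed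

section \<open>Invariant and potential of the main loop\<close>

context bipartite_nat
begin

definition expand :: "(nat \<Rightarrow> nat cw_expr) \<Rightarrow> nat \<Rightarrow> nat list" where
  "expand \<epsilon> x = (if x < 6 then [x] else encode (\<epsilon> x))"

definition pending :: "state \<Rightarrow> (nat \<Rightarrow> nat cw_expr) \<Rightarrow> bool" where
  "pending s \<epsilon> \<longleftrightarrow> (\<forall>x \<in> set (contents 7 12 s). 6 \<le> x \<longrightarrow> builds (\<epsilon> x) (class_of n s x))"

definition resolved :: "state \<Rightarrow> (nat \<Rightarrow> nat cw_expr) \<Rightarrow> bool" where
  "resolved s \<epsilon> \<longleftrightarrow> (\<exists>e. builds e {..<n} \<and>
     contents 1 1 s @ concat (map (expand \<epsilon>) (rev (contents 7 12 s))) = encode e)"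

text \<open>The last clause commits to no expressions for the pending classes: whichever valid ones
  are chosen, output and stack complete to an encoding for the whole graph. Distinctness allows one
  class to be replaced without affecting other entries; nonemptiness and \<open>one_Sperner\<close>
  ensure that a splitter exists.\<close>

definition invariant :: "nat \<Rightarrow> state \<Rightarrow> bool" where
  "invariant \<sigma> s \<longleftrightarrow> ready s \<and> 6 \<le> reg s 11 \<and> (\<forall>v<n. arr s 6 v < reg s 11) \<and>
     distinct (filter (\<lambda>x. 6 \<le> x) (contents 7 12 s)) \<and>
     (\<forall>x \<in> set (contents 7 12 s). 6 \<le> x \<longrightarrow>
        x < reg s 11 \<and> class_of n s x \<noteq> {} \<and> one_Sperner \<sigma> (class_of n s x)) \<and>
     (\<forall>\<epsilon>. pending s \<epsilon> \<longrightarrow> resolved s \<epsilon>)"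

text \<open>Splitting a class removes one vertex and pushes at most 23 numbers below 6.\<close>

definition potential :: "state \<Rightarrow> nat" where
  "potential s = length (filter (\<lambda>x. x < 6) (contents 7 12 s)) + 24 * card {v. v < n \<and> 6 \<le> arr s 6 v}"

lemma contents_pop:
  assumes "0 < reg s 12"
  shows "contents 7 12 s = contents 7 12 (set_reg 12 (reg s 12 - 1) s) @ [arr s 7 (reg s 12 - 1)]"
  using assms by (cases "reg s 12") (simp_all add: contents_def)

lemma step_token:
  assumes inv: "invariant \<sigma> s" and pos: "0 < reg s 12" and x: "arr s 7 (reg s 12 - 1) < 6"
  shows "invariant \<sigma> (sem step s) \<and> potential (sem step s) < potential s"
proof -
  let ?x = "arr s 7 (reg s 12 - 1)"
  let ?s = "set_reg 10 ?x (set_reg 12 (reg s 12 - 1) s)"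
  let ?t = "sem step s"
  let ?st = "contents 7 12 (set_reg 12 (reg s 12 - 1) s)"
  note pop = contents_pop[OF pos]
  have t: "?t = sem (append_all 1 1 [Reg 10]) ?s" using x by (simp add: step_def del: append_all.simps)
  have st: "contents 7 12 ?t = ?st" unfolding t by simp
  have out: "contents 1 1 ?t = contents 1 1 s @ [?x]"
    unfolding t by (subst contents_append_all) (auto simp: contents_def)
  have cls: "class_of n ?t = class_of n s" by (simp add: fun_eq_iff class_of_def t)
  have "ready ?t" by (rule ready_cong[of s]) (use inv in \<open>simp_all add: sem_frame invariant_def\<close>)
  moreover have "resolved ?t \<epsilon>" if "pending ?t \<epsilon>" for \<epsilon>
  proof -
    have "pending s \<epsilon>" using that x unfolding pending_def st cls pop by auto
    then have "resolved s \<epsilon>" using inv by (simp add: invariant_def)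
    then show ?thesis using x unfolding resolved_def st out pop by (simp add: expand_def)
  qed
  moreover have "reg ?t 11 = reg s 11" "arr ?t 6 = arr s 6" by (simp_all add: t)
  ultimately show ?thesis
    using inv x unfolding invariant_def potential_def st cls pop by auto
qed

lemma class_finite: "finite (class_of n s i)"
  by (simp add: class_of_def)

lemma encode_combine:
  "encode (combine C z e e') = [0, 5, z] @
     (if near C z \<noteq> {} then encode e @ [1, 3, 5, 3 - side z] else []) @
     (if far C z \<noteq> {} then encode e' @ [2, 1, 3, 2, 2, 4, 1, 3, side z, 5 - side z, 2, 3, 1, 2, 4, 2] else []) @
     [2, 5, side z]"
  by (simp add: combine_def attach_near_def attach_far_def)

lemma step_class:
  assumes inv: "invariant \<sigma> s" and pos: "0 < reg s 12" and x: "6 \<le> arr s 7 (reg s 12 - 1)"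
    and \<sigma>: "\<sigma> = 1 \<or> \<sigma> = 2"
  shows "invariant \<sigma> (sem step s) \<and> potential (sem step s) < potential s"
proof -
  let ?x = "arr s 7 (reg s 12 - 1)" and ?y = "reg s 11"
  let ?s = "set_reg 10 ?x (set_reg 12 (reg s 12 - 1) s)"
  let ?f = "sem find_splitter ?s"
  let ?g = "sem split_class ?f"
  let ?t = "sem step s"
  let ?st = "contents 7 12 (set_reg 12 (reg s 12 - 1) s)"
  note pop = contents_pop[OF pos]
  define C where "C = class_of n s ?x"
  have t: "?t = sem schedule ?g" using x by (simp add: step_def)
  have ready: "ready s" and y: "6 \<le> ?y" "?x < ?y" and cls_less: "\<And>v. v < n \<Longrightarrow> arr s 6 v < ?y"
    and C: "C \<noteq> {}" "one_Sperner \<sigma> C"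
    using inv x pop unfolding invariant_def C_def by auto
  have ready_s: "ready ?s" by (rule ready_cong[OF ready]) simp_all
  have C_s: "C = class_of n ?s (reg ?s 10)" by (simp add: C_def class_of_def)
  have finC: "finite C" unfolding C_def by (rule class_finite)
  define z where "z = reg ?f 6"
  have "\<exists>z. splitter C z" by (rule splitter_exists[OF finC C(1) \<sigma> C(2)])
  then have z: "splitter C z" unfolding z_def by (rule sem_find_splitter[OF ready_s C_s])
  then have zC: "z \<in> C" by (simp add: splitter_def)
  have ready_f: "ready ?f" by (rule ready_cong[OF ready_s]) (simp_all add: sem_frame)
  have C_f: "C = class_of n ?f (reg ?f 10)" unfolding C_s by (simp add: class_of_def sem_frame)
  have "reg ?f 11 \<noteq> reg ?f 10" using y by (simp add: sem_frame)
  note g = sem_split_class[OF ready_f C_f z_def[symmetric] zC this]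
  have CV: "v < n \<and> arr s 6 v = ?x" if "v \<in> C" for v using that by (auto simp: C_def class_of_def)
  have zN: "z \<notin> near C z" by (rule not_near_self)
  have NC: "near C z \<subseteq> C" by (auto simp: near_def)
  have NV: "v < n \<and> arr s 6 v = ?x" if "v \<in> near C z" for v using that NC CV by blast
  have arr_t: "arr ?t 6 v = (if v = z then 0 else if v \<in> near C z then ?y else arr s 6 v)" if "v < n" for v
    using g(1)[OF that] by (simp add: t sem_frame)
  define items where "items = (if near C z = {} then [] else [?y, 1, 3, 5, 3 - side z]) @
       (if far C z = {} then [] else [?x, 2, 1, 3, 2, 2, 4, 1, 3, side z, 5 - side z, 2, 3, 1, 2, 4, 2]) @
       [2, 5, side z]"
  have st: "contents 7 12 ?t = ?st @ rev items"
    unfolding t sem_schedule(2) items_def g(2,3,5) by (simp add: sem_frame)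
  have out: "contents 1 1 ?t = contents 1 1 s @ [0, 5, z]"
    unfolding t sem_schedule(1) g(4) by simp
  have y_t: "reg ?t 11 = ?y + 1" unfolding t sem_schedule(3) by (simp add: sem_frame)
  have cls_old: "class_of n ?t i = class_of n s i" if "6 \<le> i" "i \<noteq> ?x" "i < ?y" for i
    using arr_t CV zC NC NV that by (auto simp: class_of_def split: if_splits)
  have cls_x: "class_of n ?t ?x = far C z"
  proof -
    have "arr ?t 6 v = ?x \<longleftrightarrow> v \<in> far C z" if "v < n" for v
    proof -
      have "v \<in> C \<longleftrightarrow> arr s 6 v = ?x" using that by (simp add: C_def class_of_def)
      then show ?thesis using arr_t[OF that] x y by auto
    qed
    then show ?thesis using CV by (auto simp: class_of_def)
  qed
  have cls_y: "class_of n ?t ?y = near C z"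
  proof -
    have "arr ?t 6 v = ?y \<longleftrightarrow> v \<in> near C z" if "v < n" for v
      using arr_t[OF that] cls_less[OF that] zN y(1) by auto
    then show ?thesis using NV by (auto simp: class_of_def)
  qed
  have small: "side z < 6" "\<not> 6 \<le> 3 - side z" "\<not> 6 \<le> 5 - side z" using side_range[of z] by auto
  have big_items: "filter (\<lambda>x. 6 \<le> x) items =
      (if near C z = {} then [] else [?y]) @ (if far C z = {} then [] else [?x])"
    using small x y by (simp add: items_def)
  have st_props: "i < ?y \<and> i \<noteq> ?x \<and> class_of n s i \<noteq> {} \<and> one_Sperner \<sigma> (class_of n s i)"
    if "i \<in> set ?st" "6 \<le> i" for i
  proof -
    have "distinct (filter (\<lambda>x. 6 \<le> x) ?st @ [?x])"
      using inv x unfolding invariant_def pop by simp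
    then have "i \<noteq> ?x" using that by auto
    moreover have "i \<in> set (contents 7 12 s)" unfolding pop using that by simp
    ultimately show ?thesis using inv that unfolding invariant_def by blast
  qed
  have item_cases: "i = ?y \<and> near C z \<noteq> {} \<or> i = ?x \<and> far C z \<noteq> {}" if "i \<in> set items" "6 \<le> i" for i
  proof -
    have "i \<in> set (filter (\<lambda>x. 6 \<le> x) items)" using that by simp
    then show ?thesis unfolding big_items by (auto split: if_splits)
  qed
  have "ready ?t" by (rule ready_cong[OF ready]) (simp_all add: sem_frame)
  moreover have "\<forall>v<n. arr ?t 6 v < reg ?t 11"
    using arr_t cls_less y_t by (auto simp: less_Suc_eq)
  moreover have "distinct (filter (\<lambda>x. 6 \<le> x) (contents 7 12 ?t))"
  proof -
    have "distinct (filter (\<lambda>x. 6 \<le> x) ?st)" using inv unfolding invariant_def pop by simp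
    moreover have "set (filter (\<lambda>x. 6 \<le> x) ?st) \<inter> {?x, ?y} = {}" using st_props by auto
    ultimately show ?thesis
      unfolding st filter_append rev_filter[symmetric] big_items using y by auto
  qed
  moreover have "i < reg ?t 11 \<and> class_of n ?t i \<noteq> {} \<and> one_Sperner \<sigma> (class_of n ?t i)"
    if i: "i \<in> set (contents 7 12 ?t)" "6 \<le> i" for i
  proof -
    consider "i \<in> set ?st" | "i = ?y" "near C z \<noteq> {}" | "i = ?x" "far C z \<noteq> {}"
      using i item_cases unfolding st by auto
    then show ?thesis
    proof cases
      case 1
      then show ?thesis using st_props[OF 1 i(2)] cls_old[of i] i(2) y_t by simp
    next
      case 2
      then show ?thesis using one_Sperner_near[OF C(2) z] cls_y y_t by simp
    next
      case 3
      then show ?thesis using one_Sperner_far[OF C(2) z] cls_x y y_t by simp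
    qed
  qed
  moreover have "resolved ?t \<epsilon>" if pend: "pending ?t \<epsilon>" for \<epsilon>
  proof -
    \<comment> \<open>The name \<open>?x\<close> denotes the whole class before the step and only
      its far part afterwards. So the assignment for the old state sends it to the combined
      expression.\<close>
    define \<delta> where "\<delta> = \<epsilon>(?x := combine C z (\<epsilon> ?y) (\<epsilon> ?x))"
    have in_items: "near C z \<noteq> {} \<Longrightarrow> ?y \<in> set items" "far C z \<noteq> {} \<Longrightarrow> ?x \<in> set items"
      by (auto simp: items_def)
    have "builds (combine C z (\<epsilon> ?y) (\<epsilon> ?x)) C"
    proof (rule combine_builds[OF z])
      show "builds (\<epsilon> ?y) (near C z)" if "near C z \<noteq> {}"
        using pend in_items(1)[OF that] y(1) unfolding pending_def st cls_y[symmetric] by simp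
      show "builds (\<epsilon> ?x) (far C z)" if "far C z \<noteq> {}"
        using pend in_items(2)[OF that] x unfolding pending_def st cls_x[symmetric] by simp
    qed
    moreover have "builds (\<epsilon> i) (class_of n s i)" if "i \<in> set ?st" "6 \<le> i" for i
      using pend that st_props[OF that] cls_old[of i] unfolding pending_def st by auto
    ultimately have "pending s \<delta>"
      using st_props unfolding pending_def pop \<delta>_def C_def by auto
    then have "resolved s \<delta>" using inv by (simp add: invariant_def)
    then obtain e where e: "builds e {..<n}"
      "contents 1 1 s @ encode (combine C z (\<epsilon> ?y) (\<epsilon> ?x)) @ concat (map (expand \<delta>) (rev ?st)) = encode e"
      using x unfolding resolved_def pop by (auto simp: expand_def \<delta>_def)
    have rest: "map (expand \<delta>) (rev ?st) = map (expand \<epsilon>) (rev ?st)"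
      using st_props by (auto simp: expand_def \<delta>_def)
    have items: "encode (combine C z (\<epsilon> ?y) (\<epsilon> ?x)) = [0, 5, z] @ concat (map (expand \<epsilon>) items)"
      using x y small unfolding encode_combine items_def by (simp add: expand_def)
    show ?thesis
      using e(1) e(2)[unfolded rest items] unfolding resolved_def st out by (intro exI[of _ e]) simp
  qed
  moreover have "potential ?t < potential s"
  proof -
    have "6 \<le> arr ?t 6 v \<longleftrightarrow> 6 \<le> arr s 6 v \<and> v \<noteq> z" if "v < n" for v
    proof (cases "v \<in> near C z")
      case True
      then show ?thesis using arr_t[OF that] NV[OF True] x y(1) zN by auto
    next
      case False
      then show ?thesis using arr_t[OF that] by simp
    qed
    then have eq: "{v. v < n \<and> 6 \<le> arr ?t 6 v} = {v. v < n \<and> 6 \<le> arr s 6 v} - {z}" by auto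
    have "z \<in> {v. v < n \<and> 6 \<le> arr s 6 v}" using CV[OF zC] x by simp
    then have "card {v. v < n \<and> 6 \<le> arr s 6 v} = Suc (card {v. v < n \<and> 6 \<le> arr ?t 6 v})"
      unfolding eq by (intro card_Suc_Diff1[symmetric]) simp_all
    moreover have "length (filter (\<lambda>x. x < 6) (contents 7 12 ?t)) \<le>
        length (filter (\<lambda>x. x < 6) (contents 7 12 s)) + 23"
      using x y small
      unfolding st pop filter_append rev_filter[symmetric] length_append length_rev items_def by simp
    ultimately show ?thesis by (simp add: potential_def)
  qed
  ultimately show ?thesis using y y_t unfolding invariant_def by auto
qed

end

section \<open>Running time\<close>

lemma exec_While_potential:
  fixes \<phi> :: "state \<Rightarrow> nat"
  assumes wf: "well_formed p" "0 \<notin> writes p"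
    and n: "\<And>s. I s \<Longrightarrow> reg s 0 = n"
    and step: "\<And>s. I s \<Longrightarrow> bval b s \<Longrightarrow> I (sem p s) \<and> \<phi> (sem p s) < \<phi> s"
    and I: "I s"
  shows "\<exists>t s'. exec (While b (compile p)) s t s' \<and>
    t \<le> bcost b + 1 + \<phi> s * (bcost b + 1 + cost n p) \<and> I s' \<and> \<not> bval b s'"
  using I
proof (induction "\<phi> s" arbitrary: s rule: less_induct)
  case less
  show ?case
  proof (cases "bval b s")
    case False
    then show ?thesis using exec.WhileFalse[OF False, of "compile p"] less.prems
      by (intro exI[of _ "bcost b + 1"] exI[of _ s]) simp
  next
    case True
    obtain t where t: "exec (compile p) s t (sem p s)" "t \<le> cost n p"
      using exec_compile[OF wf(1) n[OF less.prems] wf(2)] by blast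
    have dec: "I (sem p s)" "\<phi> (sem p s) < \<phi> s" using step[OF less.prems True] by auto
    obtain u s' where u: "exec (While b (compile p)) (sem p s) u s'"
      "u \<le> bcost b + 1 + \<phi> (sem p s) * (bcost b + 1 + cost n p)" "I s'" "\<not> bval b s'"
      using less.hyps[OF dec(2,1)] by blast
    have "Suc (\<phi> (sem p s)) * (bcost b + 1 + cost n p) \<le> \<phi> s * (bcost b + 1 + cost n p)"
      using dec(2) by (intro mult_le_mono1) simp
    then have "bcost b + 1 + t + u \<le> bcost b + 1 + \<phi> s * (bcost b + 1 + cost n p)"
      using t(2) u(2) by simp
    with exec.WhileTrue[OF True t(1) u(1)] u(3,4) show ?thesis by blast
  qed
qed

primrec loop_depth :: "lprog \<Rightarrow> nat" where
  "loop_depth LSkip = 0"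
| "loop_depth (LAssign x a) = 0"
| "loop_depth (LStore m i a) = 0"
| "loop_depth (p ;; q) = max (loop_depth p) (loop_depth q)"
| "loop_depth (LIf b p q) = max (loop_depth p) (loop_depth q)"
| "loop_depth (LFor x p) = Suc (loop_depth p)"

text \<open>The cost is a polynomial in \<open>n\<close> with nonnegative coefficients, whose sum is \<open>cost 1 p\<close>.\<close>

lemma cost_le_power:
  assumes "0 < n" "loop_depth p \<le> d"
  shows "cost n p \<le> cost 1 p * n ^ d"
proof -
  have const: "c \<le> c * n ^ d" for c d :: nat
    using assms(1) by (cases "c = 0") simp_all
  show ?thesis
    using assms(2)
  proof (induction p arbitrary: d)
    case (LSeq p q)
    then show ?case by (simp add: add_mult_distrib add_mono)
  next
    case (LIf b p q)
    show ?case
      using LIf const[of "bcost b + 1" d] by (simp only: cost.simps loop_depth.simps add_mult_distrib max.bounded_iff) (meson add_mono)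
  next
    case (LFor x p)
    then obtain e where d: "d = Suc e" "loop_depth p \<le> e" by (cases d) auto
    have "6 + n * (cost n p + 8) \<le> 6 * n ^ d + n * (cost 1 p * n ^ e + 8 * n ^ e)"
      using LFor.IH[OF d(2)] assms(1) by (intro add_mono mult_le_mono2) simp_all
    also have "\<dots> = (6 + (cost 1 p + 8)) * n ^ d" by (simp add: d(1) algebra_simps)
    finally show ?case by simp
  qed (simp_all only: cost.simps const)
qed

lemma loop_depth_append_all [simp]: "loop_depth (append_all m r as) = 0"
  by (induction as) auto

definition prepare :: lprog where
  "prepare =
     row_offsets ;; find_sides ;; LFor 2 (LStore 6 (Reg 2) (Const 6)) ;;
     LAssign 11 (Const 7) ;; append_all 7 12 [Const 6]"

definition program :: com where
  "program = Seq (compile prepare) (While (Less (Const 0) (Reg 12)) (compile step))"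

text \<open>The initial potential is \<open>24 * n\<close>, and a test of the main loop costs 4.
  Rounds that merely copy a number are charged for a splitting as well, which costs only a constant
  factor.\<close>

definition time :: "nat \<Rightarrow> nat" where
  "time n = cost n prepare + (4 + 24 * n * (4 + cost n step))"

text \<open>Depth three is reached in \<open>find_sides\<close> and in \<open>find_splitter\<close>;
  the main loop contributes the fourth factor \<open>n\<close>.\<close>

lemma loop_depths: "loop_depth prepare \<le> 3" "loop_depth step \<le> 3"
  by (simp_all add: prepare_def row_offsets_def find_sides_def merge_components_def step_def
      find_splitter_def mark_near_def check_splitter_def split_class_def schedule_def)

lemma time_bigo: "(\<lambda>n. real (time n)) \<in> O(\<lambda>n. real n ^ 4)"
proof -
  \<comment> \<open>The 100 is \<open>24 * 4\<close> for the loop tests of the rounds plus 4 for the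
    final test.\<close>
  let ?K = "cost 1 prepare + 100 + 24 * cost 1 step"
  have "time n \<le> ?K * n ^ 4" if n: "0 < n" for n
  proof -
    have "cost n prepare \<le> cost 1 prepare * n ^ 4"
      using loop_depths by (intro cost_le_power[OF n]) simp
    moreover have "24 * n * (4 + cost n step) \<le> 24 * n * (4 * n ^ 3 + cost 1 step * n ^ 3)"
      using n cost_le_power[OF n loop_depths(2)] by (intro mult_le_mono2 add_mono) simp_all
    moreover have "24 * n * (4 * n ^ 3 + cost 1 step * n ^ 3) = (96 + 24 * cost 1 step) * n ^ 4"
      by (simp add: algebra_simps eval_nat_numeral)
    moreover have "4 \<le> 4 * n ^ 4" using n by simp
    ultimately show ?thesis unfolding time_def add_mult_distrib by linarith
  qed
  then have "real (time n) \<le> real ?K * real n ^ 4" if "0 < n" for n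
    using that by (metis of_nat_mono of_nat_mult of_nat_power)
  then show ?thesis
    by (intro bigoI[of _ "real ?K"] eventually_mono[OF eventually_gt_at_top[of 0]]) simp
qed

lemma program_correct:
  fixes G :: "nat graph"
  assumes simple: "simple_graph G" and V: "verts G = {..<n}" and bip: "bipartite G"
    and free: "\<not> has_induced G two_P3" and Sp: "right_Sperner G" and n: "0 < n"
  shows "\<exists>t s e. exec program (input_state n G) t s \<and> t \<le> time n \<and>
    output_of s = encode e \<and> k_expression 5 e \<and> expression_of e G"
proof -
  let ?i = "input_state n G"
  let ?r = "sem row_offsets ?i"
  let ?f = "sem find_sides ?r"
  let ?c = "sem (LFor 2 (LStore 6 (Reg 2) (Const 6))) ?f"
  let ?s = "sem prepare ?i"
  have EV: "u < n" "v < n" "u \<noteq> v" if "graph_adj G u v" for u v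
    using that simple V by (auto simp: graph_adj_def simple_graph_def)
  have loads: "loads n (graph_adj G) ?r"
    using simple by (intro row_offsets_loads) (auto simp: simple_graph_def)
  obtain A B where AB: "bipartition G A B" using bip by (auto simp: bipartite_def)
  have "(u \<in> A) \<noteq> (v \<in> A)" if "graph_adj G u v" for u v
    using AB EV[OF that] that V unfolding bipartition_def independent_def graph_adj_def by blast
  note sides = find_sides_proper[OF loads this]
  \<comment> \<open>Beyond the graph, 1 is a default that meets the range condition; no edges occur
    there.\<close>
  define side where "side v = (if v < n then arr ?f 3 v else 1)" for v
  interpret bipartite_nat "graph_adj G" side n
  proof
    show "graph_adj G v u" if "graph_adj G u v" for u v
      using that by (simp add: graph_adj_def insert_commute)
    show "side u \<noteq> side v" if "graph_adj G u v" for u v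
      using sides(2) that EV[OF that] by (simp add: side_def)
    show "side v = 1 \<or> side v = 2" for v using sides(1) by (simp add: side_def)
  qed
  \<comment> \<open>The computed sides may differ from the witnessing bipartition. Which side
    satisfies the condition matters only for the proof; the program never needs to know.\<close>
  obtain \<sigma> where \<sigma>: "\<sigma> = 1 \<or> \<sigma> = 2" "one_Sperner \<sigma> {..<n}"
    using one_Sperner_bipartition[OF bipartite_relation_axioms simple free Sp] V by auto
  have s: "?s = sem (append_all 7 12 [Const 6]) (set_reg 11 7 ?c)" by (simp add: prepare_def)
  have st: "contents 7 12 ?s = [6]"
    unfolding s by (subst contents_append_all) (simp_all add: contents_def sem_frame input_state_def)
  have out: "contents 1 1 ?s = []"
    unfolding s by (simp add: contents_def sem_frame input_state_def)
  have "ready ?f"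
    unfolding ready_def using loads by (auto simp: side_def sem_frame intro: loads_cong)
  then have ready: "ready ?s" by (rule ready_cong) (simp_all add: s sem_frame)
  have n2: "reg ?f 0 = n" using \<open>ready ?f\<close> by (rule readyD)
  have "\<forall>v<n. arr ?c 6 v = 6"
    by (rule sem_LFor[where I = "\<lambda>k t. \<forall>v<k. arr t 6 v = 6"]) (auto simp: n2 less_Suc_eq)
  then have cls: "\<forall>v<n. arr ?s 6 v = 6" by (simp add: s sem_frame)
  then have cls': "class_of n ?s 6 = {..<n}" by (auto simp: class_of_def)
  have fresh: "reg ?s 11 = 7" by (simp add: s sem_frame)
  have "resolved ?s \<epsilon>" if "pending ?s \<epsilon>" for \<epsilon>
    using that unfolding resolved_def pending_def st out cls' by (auto simp: expand_def cls')
  then have inv: "invariant \<sigma> ?s"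
    unfolding invariant_def st using ready fresh cls cls' \<sigma> n by auto
  have pot: "potential ?s = 24 * n"
  proof -
    have "{v. v < n \<and> 6 \<le> arr ?s 6 v} = {..<n}" using cls by auto
    then show ?thesis by (simp add: potential_def st)
  qed
  have "\<exists>t s'. exec (While (Less (Const 0) (Reg 12)) (compile step)) ?s t s' \<and>
      t \<le> bcost (Less (Const 0) (Reg 12)) + 1 +
        potential ?s * (bcost (Less (Const 0) (Reg 12)) + 1 + cost n step) \<and>
      invariant \<sigma> s' \<and> \<not> bval (Less (Const 0) (Reg 12)) s'"
  proof (rule exec_While_potential[where I = "invariant \<sigma>" and s = ?s])
    show "reg s 0 = n" if "invariant \<sigma> s" for s
      using that readyD(1) by (simp add: invariant_def)
    show "invariant \<sigma> (sem step s) \<and> potential (sem step s) < potential s"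
      if "invariant \<sigma> s" "bval (Less (Const 0) (Reg 12)) s" for s
      using step_token[of \<sigma> s] step_class[of \<sigma> s] \<sigma>(1) that by (cases "arr s 7 (reg s 12 - 1) < 6") auto
  qed (use inv in simp_all)
  then obtain t s' where loop: "exec (While (Less (Const 0) (Reg 12)) (compile step)) ?s t s'"
    "t \<le> 4 + 24 * n * (4 + cost n step)" and inv': "invariant \<sigma> s'" and stop: "reg s' 12 = 0"
    unfolding pot by (auto simp: eval_nat_numeral)
  obtain u where u: "exec (compile prepare) ?i u ?s" "u \<le> cost n prepare"
  proof -
    have "well_formed prepare" "0 \<notin> writes prepare" "reg ?i 0 = n"
      by (simp_all add: prepare_def input_state_def)
    then show thesis using exec_compile[of prepare ?i n] that by blast
  qed
  have run: "exec program ?i (u + t) s'" "u + t \<le> time n"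
    using exec.Seq[OF u(1) loop(1)] u(2) loop(2) by (simp_all add: program_def time_def)
  have empty: "contents 7 12 s' = []" using stop by (simp add: contents_def)
  \<comment> \<open>With an empty stack no class is pending, so every assignment qualifies and the
    output by itself is a complete encoding.\<close>
  then have "resolved s' undefined"
    using inv' unfolding invariant_def by (simp add: pending_def)
  then obtain e where e: "builds e {..<n}" "contents 1 1 s' = encode e"
    unfolding resolved_def empty by auto
  have "edges_within (graph_adj G) {..<n} = edges G"
  proof
    show "edges G \<subseteq> edges_within (graph_adj G) {..<n}"
    proof
      fix X assume X: "X \<in> edges G"
      then obtain x y where "X = {x, y}" "X \<subseteq> {..<n}"
        using simple V unfolding simple_graph_def by (metis card_2_iff)
      with X show "X \<in> edges_within (graph_adj G) {..<n}"
        unfolding edges_within_def graph_adj_def by auto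
    qed
  qed (auto simp: edges_within_def graph_adj_def)
  then have "k_expression 5 e" "expression_of e G"
    using e(1) V by (simp_all add: builds_def expression_of_def)
  with run e(2) show ?thesis unfolding output_of_def contents_def by blast
qed

theorem theorem6p4:
  "(\<forall>G :: 'a graph.
      simple_graph G \<and> verts G \<noteq> {} \<and> bipartite G \<and> \<not> has_induced G two_P3 \<and>
      right_Sperner G \<longrightarrow> clique_width G \<le> 5) \<and>
   (\<exists>(p :: com) (T :: nat \<Rightarrow> nat).
      (\<lambda>n. real (T n)) \<in> O(\<lambda>n. real n ^ 4) \<and>
      (\<forall>(n :: nat) (G :: nat graph).
         simple_graph G \<and> n > 0 \<and> verts G = {..<n} \<and> bipartite G \<and>
         \<not> has_induced G two_P3 \<and> right_Sperner G \<longrightarrow>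
         (\<exists>t s e. exec p (input_state n G) t s \<and> t \<le> T n \<and>
            output_of s = encode e \<and> k_expression 5 e \<and> expression_of e G)))"
proof (intro conjI allI impI)
  fix G :: "'a graph"
  assume G: "simple_graph G \<and> verts G \<noteq> {} \<and> bipartite G \<and> \<not> has_induced G two_P3 \<and> right_Sperner G"
  then have "simple_graph G" by simp
  then obtain H :: "nat graph" where H: "verts H = {..<card (verts G)}" "simple_graph H" "graph_iso H G"
    "bipartite G \<Longrightarrow> bipartite H" "right_Sperner G \<Longrightarrow> right_Sperner H"
    "\<And>K :: nat graph. has_induced H K \<Longrightarrow> has_induced G K"
    by (rule nat_copy) (rule that; blast)
  have "0 < card (verts G)" using G by (auto simp: simple_graph_def card_gt_0_iff)
  then obtain e where e: "k_expression 5 e" "expression_of e H"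
    using program_correct[OF H(2,1)] H(4-6) G by blast
  then have "graph_iso (graph_of e) G"
    using H(3) by (simp add: graph_iso_def expression_of_def)
  with e(1) have "clique_width G \<le> enat 5"
    unfolding clique_width_def by (intro Inf_lower) blast
  then show "clique_width G \<le> 5" by (simp add: numeral_eq_enat)
next
  show "\<exists>(p :: com) (T :: nat \<Rightarrow> nat).
      (\<lambda>n. real (T n)) \<in> O(\<lambda>n. real n ^ 4) \<and>
      (\<forall>(n :: nat) (G :: nat graph).
         simple_graph G \<and> n > 0 \<and> verts G = {..<n} \<and> bipartite G \<and>
         \<not> has_induced G two_P3 \<and> right_Sperner G \<longrightarrow>
         (\<exists>t s e. exec p (input_state n G) t s \<and> t \<le> T n \<and>
            output_of s = encode e \<and> k_expression 5 e \<and> expression_of e G))"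
    using time_bigo program_correct by (intro exI[of _ program] exI[of _ time]) blast
qed

end
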